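(* Let $N\in\mathbb{N}$, $0<\nu\le\frac1N$, $\Lambda>0$, and set $\nu_j=j\nu$, $j=1,\dots,N$. Let $\mu_1,\dots,\mu_N\ge0$ be such that, identically in $x$, $$\sum_{j=1}^N\mu_jx^j+\Lambda=\prod_{j=1}^M(x-\eta_j)^{m_j},\qquad \eta_j\in\mathbb{R},\quad \sum_{j=1}^Mm_j=N,$$ with positive integers $m_1,\dots,m_M$. Let $\mathcal{N}_\Lambda$ be a homogeneous Poisson process with rate $\Lambda$, independent of the inverse process $\mathcal{L}^\nu$ of $\sum_{j=1}^N\mu_j^{1/\nu_j}H_j^{\nu_j}(t)$, and let $p_k^\nu(t)=\mathsf{P}\{\mathcal{N}_\Lambda(\mathcal{L}^\nu(t))=k\}$, which solve $$\sum_{j=1}^N\mu_j\frac{d^{\nu_j}}{dt^{\nu_j}}p_k^\nu(t)=-\Lambda\left(p_k^\nu(t)-p_{k-1}^\nu(t)\right),\quad k\ge0,$$ with $p_{-1}^\nu\equiv0$, $p_0^\nu(0)=1$, $p_k^\nu(0)=0$ for $k\ge1$ (Caputo–Djrbashian derivatives). Then $$p_k^\nu(t)=\Lambda^k\sum_{j=1}^N\mu_jt^{\delta_j-1}E_{\nu,\delta_j}^{\gamma_1,\dots,\gamma_M}(\eta_1t^\nu,\dots,\eta_Mt^\nu),$$ where $\gamma_j=m_j(k+1)$ for $j=1,\dots,M$ and $\delta_j=\nu(N(k+1)-j)+1$ for $j=1,\dots,N$.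
   Context: For $\beta\in(0,1)$, a stable subordinator $H^{\beta}$ is a nondecreasing Lévy process with $\mathsf{E}e^{-sH^{\beta}(t)}=e^{-ts^{\beta}}$, $s>0$; for $\beta=1$ set $H^1(t)=t$. $H_1^{\nu_1},\dots,H_N^{\nu_N}$ are independent stable subordinators of orders $\nu_1,\dots,\nu_N$ (terms with $\mu_j=0$ vanish). The inverse process is $$\mathcal{L}^\nu(t)=\inf\Big\{s>0:\sum_{j=1}^N\mu_j^{1/\nu_j}H_j^{\nu_j}(s)\ge t\Big\},\quad t>0,\qquad \mathcal{L}^\nu(0)=0.$$ The Caputo–Djrbashian derivative of order $\beta\in(0,1)$ is $\frac{d^{\beta}}{dt^{\beta}}u(t)=\frac{1}{\Gamma(1-\beta)}\int_0^t \frac{u'(s)}{(t-s)^{\beta}}\,ds$; for $\beta=1$ it is the ordinary derivative. The multivariate Mittag-Leffler function is $$E_{\alpha,\beta}^{\gamma_1,\dots,\gamma_m}(z_1,\dots,z_m)=\sum_{k_1=0}^\infty\cdots\sum_{k_m=0}^\infty\frac{(\gamma_1)_{k_1}\cdots(\gamma_m)_{k_m}}{\Gamma\big(\alpha\sum_{j=1}^mk_j+\beta\big)}\frac{z_1^{k_1}}{k_1!}\cdots\frac{z_m^{k_m}}{k_m!},$$ with $(\gamma)_0=1$, $(\gamma)_r=\gamma(\gamma+1)\cdots(\gamma+r-1)$. *)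

theory Defs
  imports "HOL-Probability.Probability"
begin

section \<open>Processes\<close>

text \<open>A real process with time set \<open>[0, \<infinity>)\<close> is a function
  \<open>X :: real \<Rightarrow> 'w \<Rightarrow> real\<close> whose values at negative times are irrelevant.  Independence of
  whole processes is independence of the path-valued random variables \<open>sample_path X\<close>, where path space
  carries the product sigma-algebra.\<close>

abbreviation path_space :: "(real \<Rightarrow> real) measure" where
  "path_space \<equiv> PiM {0..} (\<lambda>_. borel)"

definition sample_path :: "(real \<Rightarrow> 'w \<Rightarrow> real) \<Rightarrow> 'w \<Rightarrow> real \<Rightarrow> real" where
  "sample_path X \<omega> = (\<lambda>t\<in>{0..}. X t \<omega>)"

definition levy_process :: "'w measure \<Rightarrow> (real \<Rightarrow> 'w \<Rightarrow> real) \<Rightarrow> bool" where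
  "levy_process P X \<longleftrightarrow>
     (\<forall>t\<ge>0. X t \<in> borel_measurable P) \<and>
     (AE \<omega> in P. X 0 \<omega> = 0) \<and>
     (\<forall>n. \<forall>\<tau> :: nat \<Rightarrow> real. 0 \<le> \<tau> 0 \<and> (\<forall>i<n. \<tau> i \<le> \<tau> (Suc i)) \<longrightarrow>
        prob_space.indep_vars P (\<lambda>_. borel) (\<lambda>i \<omega>. X (\<tau> (Suc i)) \<omega> - X (\<tau> i) \<omega>) {..<n}) \<and>
     (\<forall>s\<ge>0. \<forall>h\<ge>0. distr P borel (\<lambda>\<omega>. X (s + h) \<omega> - X s \<omega>) = distr P borel (X h)) \<and>
     (\<forall>t\<ge>0. \<forall>\<epsilon>>0.
        ((\<lambda>s. measure P {\<omega> \<in> space P. \<bar>X s \<omega> - X t \<omega>\<bar> > \<epsilon>}) \<longlongrightarrow> 0) (at t within {0..})) \<and>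
     (AE \<omega> in P. \<forall>t\<ge>0. continuous (at_right t) (\<lambda>s. X s \<omega>) \<and>
        (t > 0 \<longrightarrow> (\<exists>l. ((\<lambda>s. X s \<omega>) \<longlongrightarrow> l) (at_left t))))"

definition stable_subordinator :: "'w measure \<Rightarrow> real \<Rightarrow> (real \<Rightarrow> 'w \<Rightarrow> real) \<Rightarrow> bool" where
  "stable_subordinator P \<beta> H \<longleftrightarrow>
     (if \<beta> = 1 then \<forall>t\<ge>0. \<forall>\<omega>\<in>space P. H t \<omega> = t
      else 0 < \<beta> \<and> \<beta> < 1 \<and> levy_process P H \<and>
        (AE \<omega> in P. mono_on {0..} (\<lambda>t. H t \<omega>)) \<and>
        (\<forall>t\<ge>0. \<forall>s>0. (\<integral>\<omega>. exp (- s * H t \<omega>) \<partial>P) = exp (- t * s powr \<beta>)))"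

definition poisson_process :: "'w measure \<Rightarrow> real \<Rightarrow> (real \<Rightarrow> 'w \<Rightarrow> nat) \<Rightarrow> bool" where
  "poisson_process P \<Lambda> A \<longleftrightarrow>
     levy_process P (\<lambda>t \<omega>. real (A t \<omega>)) \<and>
     (\<forall>t\<ge>0. \<forall>k. measure P {\<omega> \<in> space P. A t \<omega> = k} = exp (- \<Lambda> * t) * (\<Lambda> * t) ^ k / fact k)"

text \<open>The inverse of \<open>\<Sum>\<^sub>j \<mu>\<^sub>j\<^bsup>1/\<nu>\<^sub>j\<^esup> H\<^sub>j\<close> with \<open>\<nu>\<^sub>j = j \<nu>\<close>.  Since \<open>0 powr a = 0\<close>, terms with
  \<open>\<mu>\<^sub>j = 0\<close> vanish.\<close>

definition inverse_process ::
  "nat \<Rightarrow> real \<Rightarrow> (nat \<Rightarrow> real) \<Rightarrow> (nat \<Rightarrow> real \<Rightarrow> 'w \<Rightarrow> real) \<Rightarrow> real \<Rightarrow> 'w \<Rightarrow> real" where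
  "inverse_process N \<nu> \<mu> H t \<omega> =
     (if t > 0
      then Inf {s. s > 0 \<and> (\<Sum>j=1..N. \<mu> j powr (1 / (real j * \<nu>)) * H j s \<omega>) \<ge> t}
      else 0)"

text \<open>The path properties of the processes hold only almost surely (and the infimum above may be
  taken over the empty set on a null set), so the inverse process and the time-changed Poisson
  process are random variables on the completion of \<open>P\<close>.  On events of \<open>P\<close> the completion
  agrees with \<open>P\<close>.\<close>

definition time_changed_poisson_prob ::
  "'w measure \<Rightarrow> nat \<Rightarrow> real \<Rightarrow> (nat \<Rightarrow> real) \<Rightarrow> (nat \<Rightarrow> real \<Rightarrow> 'w \<Rightarrow> real) \<Rightarrow>
   (real \<Rightarrow> 'w \<Rightarrow> nat) \<Rightarrow> nat \<Rightarrow> real \<Rightarrow> real" where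
  "time_changed_poisson_prob P N \<nu> \<mu> H A k t =
     measure (completion P) {\<omega> \<in> space P. A (inverse_process N \<nu> \<mu> H t \<omega>) \<omega> = k}"

section \<open>Caputo--Djrbashian derivatives\<close>

definition caputo_deriv :: "real \<Rightarrow> (real \<Rightarrow> real) \<Rightarrow> real \<Rightarrow> real" where
  "caputo_deriv \<beta> u t =
     (if \<beta> = 1 then deriv u t
      else 1 / Gamma (1 - \<beta>) * (LBINT s:{0<..<t}. deriv u s / (t - s) powr \<beta>))"

text \<open>Existence of the derivative: \<open>deriv\<close> and the integral are total functions, so well-definedness
  has to be stated separately.\<close>

definition caputo_differentiable :: "real \<Rightarrow> (real \<Rightarrow> real) \<Rightarrow> real \<Rightarrow> bool" where
  "caputo_differentiable \<beta> u t \<longleftrightarrow>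
     (if \<beta> = 1 then u differentiable (at t)
      else (\<forall>s\<in>{0<..<t}. u differentiable (at s)) \<and>
        set_integrable lborel {0<..<t} (\<lambda>s. deriv u s / (t - s) powr \<beta>))"

definition solves_fractional_poisson ::
  "nat \<Rightarrow> real \<Rightarrow> (nat \<Rightarrow> real) \<Rightarrow> real \<Rightarrow> (nat \<Rightarrow> real \<Rightarrow> real) \<Rightarrow> bool" where
  "solves_fractional_poisson N \<nu> \<mu> \<Lambda> p \<longleftrightarrow>
     (\<forall>k. continuous_on {0..} (p k)) \<and>
     p 0 0 = 1 \<and> (\<forall>k\<ge>1. p k 0 = 0) \<and>
     (\<forall>k. \<forall>t>0.
        (\<forall>j\<in>{1..N}. caputo_differentiable (real j * \<nu>) (p k) t) \<and>
        (\<Sum>j=1..N. \<mu> j * caputo_deriv (real j * \<nu>) (p k) t) =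
          - \<Lambda> * (p k t - (if k = 0 then 0 else p (k - 1) t)))"

section \<open>Multivariate Mittag-Leffler function\<close>

text \<open>The parameters \<open>\<gamma>\<^sub>j\<close> and arguments \<open>z\<^sub>j\<close> are indexed by \<open>j = 1, \<dots>, m\<close>; the \<open>m\<close>-fold series,
  which converges absolutely for \<open>\<alpha> > 0\<close>, is a sum over multi-indices.\<close>

definition mittag_leffler ::
  "real \<Rightarrow> real \<Rightarrow> nat \<Rightarrow> (nat \<Rightarrow> real) \<Rightarrow> (nat \<Rightarrow> real) \<Rightarrow> real" where
  "mittag_leffler \<alpha> \<beta> m \<gamma> z =
     (\<Sum>\<^sub>\<infinity>k \<in> {1..m} \<rightarrow>\<^sub>E (UNIV :: nat set).
        (\<Prod>j=1..m. pochhammer (\<gamma> j) (k j)) / Gamma (\<alpha> * real (\<Sum>j=1..m. k j) + \<beta>) *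
        (\<Prod>j=1..m. z j ^ k j / fact (k j)))"

text \<open>Real powers with \<open>0\<^sup>0 = 1\<close> (whereas \<open>0 powr 0 = 0\<close>), needed for the value of
  \<open>t\<^bsup>\<delta>-1\<^esup>\<close> at \<open>t = 0\<close> when \<open>\<delta> = 1\<close>.\<close>

definition rpow :: "real \<Rightarrow> real \<Rightarrow> real" where
  "rpow t a = (if a = 0 then 1 else t powr a)"

end

theory Submission
  imports Defs
begin

text \<open>
  Write \<open>B(x) = \<Sum>\<^sub>j \<mu>\<^sub>j x\<^bsup>N-j\<^esup>\<close> and \<open>Q(x) = B(x) + \<Lambda> x\<^sup>N\<close>.  Substituting \<open>1/x\<close> into the assumed factorisation and
  clearing denominators gives \<open>Q(x) = \<Prod>\<^sub>j (1 - \<eta>\<^sub>j x)\<^bsup>m\<^sub>j\<^esup>\<close>.  Everything below is a translation of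
  identities between the rational functions
  \<open>\<phi>\<^sub>k = \<Lambda>\<^sup>k x\<^bsup>Nk\<^esup> B / Q\<^bsup>k+1\<^esup>\<close> and \<open>\<psi>\<^sub>k = (\<Lambda> x\<^sup>N / Q)\<^bsup>k+1\<^esup>\<close>
  into identities between functions of time.  The dictionary is the map
  \<open>\<Sum>\<^sub>n a\<^sub>n x\<^sup>n \<mapsto> \<Sum>\<^sub>n a\<^sub>n t\<^bsup>\<nu>n\<^esup> / \<Gamma>(\<nu>n + 1)\<close> (\<open>borel_transform\<close>), which converges for all \<open>t\<close> as soon as the
  power series has a positive radius of convergence.  Three facts about this map are needed:

  \<^item> the Caputo derivative of order \<open>j \<nu>\<close> acts as division by \<open>x\<^sup>j\<close> when no negative powers arise
    (\<open>caputo_borel_transform\<close>);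

  \<^item> the Laplace transform at \<open>\<lambda>\<close> is the value of the power series at \<open>x = \<lambda>\<^bsup>-\<nu>\<^esup>\<close>, divided by \<open>\<lambda>\<close>
    (\<open>laplace_borel_transform\<close>);

  \<^item> the Mittag-Leffler function in the theorem is the image of
    \<open>x\<^sup>d \<Prod>\<^sub>i (1 - \<eta>\<^sub>i x)\<^bsup>-\<gamma>\<^sub>i\<^esup>\<close> (\<open>mittag_leffler_eq_borel_transform\<close>), so that the asserted formula for \<open>p\<^sub>k\<close>
    is the image of \<open>\<phi>\<^sub>k\<close>.

  With these, the fractional equations amount to
  \<open>x\<^bsup>-N\<^esup> B (\<phi>\<^sub>k - \<phi>\<^sub>k(0)) = - \<Lambda> (\<phi>\<^sub>k - \<phi>\<^bsub>k-1\<^esub>)\<close> with \<open>\<phi>\<^bsub>-1\<^esub> = 0\<close>, which is immediate from \<open>Q = B + \<Lambda> x\<^sup>N\<close>; negative powers do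
  not occur because \<open>\<phi>\<^sub>k - \<phi>\<^sub>k(0)\<close> is divisible by \<open>x\<^sup>N\<close>.

  It remains to identify \<open>p\<^sub>k\<close> with the image of \<open>\<phi>\<^sub>k\<close>.  Let \<open>S(s)\<close> be the sum of the scaled subordinators,
  whose Laplace exponent is \<open>f(\<lambda>) = \<Sum>\<^sub>j \<mu>\<^sub>j \<lambda>\<^bsup>j\<nu>\<^esup>\<close>.  More than \<open>k\<close> Poisson events have happened by the operational
  time \<open>L(t)\<close> exactly when \<open>L(t)\<close> exceeds an independent Erlang time with \<open>k + 1\<close> stages, and \<open>L(t) > s\<close> means
  \<open>S(s) < t\<close> up to boundary cases of measure zero.  Hence \<open>1 - (p\<^sub>0 + \<dots> + p\<^sub>k)(t)\<close> is the distribution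
  function of \<open>S\<close> sampled at an independent Erlang time (\<open>integral_erlang_CDF_first_passage\<close>).  That
  distribution has Laplace transform \<open>(\<Lambda> / (\<Lambda> + f(\<lambda>)))\<^bsup>k+1\<^esup> = \<psi>\<^sub>k(\<lambda>\<^bsup>-\<nu>\<^esup>)\<close>, so by uniqueness of Laplace
  transforms its distribution function is the image of \<open>\<psi>\<^sub>k\<close>, and \<open>\<phi>\<^sub>k = \<psi>\<^bsub>k-1\<^esub> - \<psi>\<^sub>k\<close>
  with \<open>\<psi>\<^bsub>-1\<^esub> = 1\<close>.  Distribution functions are preferred to \<open>p\<^sub>k\<close> itself because they keep all Fubini
  arguments on probability measures.
\<close>

section \<open>Power series with positive radius of convergence\<close>

lemma conv_radius_pos_mult:
  fixes f g :: "real fps"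
  assumes "fps_conv_radius f > 0" "fps_conv_radius g > 0"
  shows "fps_conv_radius (f * g) > 0"
  using fps_conv_radius_mult[of f g] assms by (auto simp: min_def intro: less_le_trans split: if_splits)

lemma conv_radius_pos_power: "fps_conv_radius (f :: real fps) > 0 \<Longrightarrow> fps_conv_radius (f ^ n) > 0"
  using fps_conv_radius_power[of f n] by (rule less_le_trans[rotated])

lemma conv_radius_pos_add:
  fixes f g :: "real fps"
  assumes "fps_conv_radius f > 0" "fps_conv_radius g > 0"
  shows "fps_conv_radius (f + g) > 0"
  using fps_conv_radius_add[of f g] assms by (auto simp: min_def intro: less_le_trans split: if_splits)

lemma conv_radius_pos_sum:
  fixes f :: "'a \<Rightarrow> real fps"
  assumes "\<And>x. x \<in> A \<Longrightarrow> fps_conv_radius (f x) > 0"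
  shows "fps_conv_radius (\<Sum>x\<in>A. f x) > 0"
  using assms by (induction A rule: infinite_finite_induct) (auto intro!: conv_radius_pos_add)

lemma conv_radius_pos_prod:
  fixes f :: "'a \<Rightarrow> real fps"
  assumes "\<And>x. x \<in> A \<Longrightarrow> fps_conv_radius (f x) > 0"
  shows "fps_conv_radius (\<Prod>x\<in>A. f x) > 0"
  using assms by (induction A rule: infinite_finite_induct) (auto intro!: conv_radius_pos_mult)

section \<open>A fractional Borel transform of power series\<close>

text \<open>Restrict the integral defining \<open>\<Gamma>(x + 1)\<close> to \<open>[t, \<infinity>)\<close> and bound \<open>s\<^sup>x\<close> below by \<open>t\<^sup>x\<close> there.  This crude
  bound replaces Stirling's formula in all convergence questions below.\<close>

lemma powr_le_exp_mult_Gamma: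
  fixes t x :: real
  assumes "t \<ge> 0" "x \<ge> 0"
  shows "t powr x \<le> exp t * Gamma (x + 1)"
proof -
  have "ennreal (t powr x * exp (- t)) = ennreal (t powr x) * ennreal (0 - (- exp (- t)))"
    by (simp add: ennreal_mult)
  also have "ennreal (0 - (- exp (- t))) = (\<integral>\<^sup>+s. ennreal (exp (- s)) * indicator {t..} s \<partial>lborel)"
    by (intro nn_integral_FTC_atLeast[symmetric, where F = "\<lambda>s. - exp (- s)"])
       (use tendsto_minus[OF filterlim_compose[OF exp_at_bot filterlim_uminus_at_bot_at_top]] in
         \<open>auto intro!: derivative_eq_intros\<close>)
  also have "ennreal (t powr x) * \<dots> = (\<integral>\<^sup>+s. ennreal (t powr x) * (ennreal (exp (- s)) * indicator {t..} s) \<partial>lborel)"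
    by (intro nn_integral_cmult[symmetric]) auto
  also have "\<dots> \<le> (\<integral>\<^sup>+s. ennreal (indicator {0..} s * s powr (x + 1 - 1) / exp s) \<partial>lborel)"
  proof (intro nn_integral_mono)
    fix s :: real
    show "ennreal (t powr x) * (ennreal (exp (- s)) * indicator {t..} s)
        \<le> ennreal (indicator {0..} s * s powr (x + 1 - 1) / exp s)"
      using assms powr_mono2[of x t s]
      by (auto simp: indicator_def ennreal_mult[symmetric] exp_minus field_simps intro!: ennreal_leI)
  qed
  also have "\<dots> = ennreal (Gamma (x + 1))"
    using assms by (intro Gamma_conv_nn_integral_real[symmetric]) simp
  finally have "t powr x * exp (- t) \<le> Gamma (x + 1)"
    using assms by (subst (asm) ennreal_le_iff) (auto intro: less_imp_le[OF Gamma_real_pos])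
  thus ?thesis by (simp add: exp_minus field_simps)
qed

text \<open>The previous bound at a rescaled point trades the factor \<open>y\<^sup>n\<close> for \<open>r\<^sup>n\<close> with an arbitrarily small \<open>r\<close>, at the
  price of a constant.\<close>

lemma power_div_Gamma_le:
  fixes y r \<nu> :: real
  assumes "y \<ge> 0" "r > 0" "\<nu> > 0"
  shows "y ^ n / Gamma (\<nu> * real n + 1) \<le> r ^ n * exp ((y / r) powr (1 / \<nu>))"
proof -
  have G: "Gamma (\<nu> * real n + 1) > 0" using assms by (intro Gamma_real_pos) (simp add: add_nonneg_pos)
  have "(y / r) ^ n \<le> exp ((y / r) powr (1 / \<nu>)) * Gamma (\<nu> * real n + 1)"
  proof (cases "y = 0 \<or> n = 0")
    case True
    show ?thesis
    proof (cases "n = 0")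
      case True thus ?thesis by simp
    next
      case False thus ?thesis using True G by (simp add: zero_power)
    qed
  next
    case False
    hence y: "y / r > 0" using assms by simp
    have "((y / r) powr (1 / \<nu>)) powr (\<nu> * real n) = (y / r) powr (real n)"
      using assms by (simp add: powr_powr)
    also have "\<dots> = (y / r) ^ n" using y by (rule powr_realpow)
    finally show ?thesis
      using powr_le_exp_mult_Gamma[of "(y / r) powr (1 / \<nu>)" "\<nu> * real n"] assms by simp
  qed
  hence "y ^ n \<le> r ^ n * (exp ((y / r) powr (1 / \<nu>)) * Gamma (\<nu> * real n + 1))"
    using assms by (simp add: power_divide field_simps)
  thus ?thesis using G by (simp add: field_simps)
qed

definition borel_fps :: "real \<Rightarrow> real fps \<Rightarrow> real fps" where
  "borel_fps \<nu> \<phi> = Abs_fps (\<lambda>n. fps_nth \<phi> n / Gamma (\<nu> * real n + 1))"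

text \<open>The image of \<open>x\<^sup>n\<close> is \<open>t\<^bsup>\<nu>n\<^esup> / \<Gamma>(\<nu>n + 1)\<close>; for \<open>\<nu> = 1\<close> this is the classical Borel transform.  Writing it as
  an entire power series evaluated at \<open>t\<^sup>\<nu>\<close> makes continuity and differentiability facts about power series, and
  it gives the value \<open>a\<^sub>0\<close> at \<open>t = 0\<close>.\<close>

definition borel_transform :: "real \<Rightarrow> real fps \<Rightarrow> real \<Rightarrow> real" where
  "borel_transform \<nu> \<phi> t = eval_fps (borel_fps \<nu> \<phi>) (t powr \<nu>)"

lemma fps_nth_borel_fps [simp]: "fps_nth (borel_fps \<nu> \<phi>) n = fps_nth \<phi> n / Gamma (\<nu> * real n + 1)"
  by (simp add: borel_fps_def)

lemma conv_radius_posE: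
  fixes \<phi> :: "real fps"
  assumes "fps_conv_radius \<phi> > 0"
  obtains r where "r > 0" "summable (\<lambda>n. \<bar>fps_nth \<phi> n\<bar> * r ^ n)"
proof -
  obtain r where r: "0 < r" "ereal r < fps_conv_radius \<phi>"
    using assms ereal_dense2[of 0 "fps_conv_radius \<phi>"] by auto
  have "summable (\<lambda>n. norm (fps_nth \<phi> n * r ^ n))"
    using r by (intro norm_summable_fps) auto
  moreover have "(\<lambda>n. norm (fps_nth \<phi> n * r ^ n)) = (\<lambda>n. \<bar>fps_nth \<phi> n\<bar> * r ^ n)"
    using r by (auto simp: abs_mult)
  ultimately show ?thesis using that r by auto
qed

lemma fps_conv_radius_borel_fps:
  assumes "\<nu> > 0" "fps_conv_radius \<phi> > 0"
  shows "fps_conv_radius (borel_fps \<nu> \<phi>) = \<infinity>"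
proof -
  obtain r where r: "r > 0" "summable (\<lambda>n. \<bar>fps_nth \<phi> n\<bar> * r ^ n)"
    using conv_radius_posE[OF assms(2)] by metis
  have "summable (\<lambda>n. fps_nth (borel_fps \<nu> \<phi>) n * of_real y ^ n)" if "y > 0" for y :: real
  proof (rule summable_comparison_test'[where N = 0])
    show "summable (\<lambda>n. \<bar>fps_nth \<phi> n\<bar> * r ^ n * exp ((y / r) powr (1 / \<nu>)))"
      using r by (intro summable_mult2)
    fix n :: nat
    have G: "Gamma (\<nu> * real n + 1) > 0" using assms by (intro Gamma_real_pos) (simp add: add_nonneg_pos)
    have "norm (fps_nth (borel_fps \<nu> \<phi>) n * of_real y ^ n) = \<bar>fps_nth \<phi> n\<bar> * (y ^ n / Gamma (\<nu> * real n + 1))"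
      using G that by (simp add: abs_mult)
    also have "\<dots> \<le> \<bar>fps_nth \<phi> n\<bar> * (r ^ n * exp ((y / r) powr (1 / \<nu>)))"
      using power_div_Gamma_le[of y r \<nu> n] that r assms by (intro mult_left_mono) auto
    finally show "norm (fps_nth (borel_fps \<nu> \<phi>) n * of_real y ^ n) \<le> \<bar>fps_nth \<phi> n\<bar> * r ^ n * exp ((y / r) powr (1 / \<nu>))"
      by simp
  qed
  hence "\<exists>z. norm z = y \<and> summable (\<lambda>n. fps_nth (borel_fps \<nu> \<phi>) n * z ^ n)" if "y > 0" for y :: real
    using that by (intro exI[of _ y]) simp
  thus ?thesis unfolding fps_conv_radius_def
    by (intro conv_radius_inftyI'[where c = 0]) blast
qed

lemma borel_transform_sums:
  assumes "\<nu> > 0" "fps_conv_radius \<phi> > 0"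
  shows "(\<lambda>n. fps_nth \<phi> n / Gamma (\<nu> * real n + 1) * (t powr \<nu>) ^ n) sums borel_transform \<nu> \<phi> t"
  using sums_eval_fps[of "t powr \<nu>" "borel_fps \<nu> \<phi>"] fps_conv_radius_borel_fps[OF assms]
  by (simp add: borel_transform_def)

lemma continuous_on_borel_transform:
  assumes "\<nu> > 0" "fps_conv_radius \<phi> > 0"
  shows "continuous_on {0..} (borel_transform \<nu> \<phi>)"
  unfolding borel_transform_def using assms
  by (intro continuous_on_eval_fps' continuous_on_powr' continuous_intros)
     (auto simp: fps_conv_radius_borel_fps)

lemma borel_transform_at_0: "\<nu> > 0 \<Longrightarrow> borel_transform \<nu> \<phi> 0 = fps_nth \<phi> 0"
  by (simp add: borel_transform_def eval_fps_at_0)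

lemma borel_transform_cmult:
  assumes "\<nu> > 0" "fps_conv_radius \<phi> > 0"
  shows "borel_transform \<nu> (fps_const c * \<phi>) t = c * borel_transform \<nu> \<phi> t"
proof -
  have "(\<lambda>n. c * (fps_nth \<phi> n / Gamma (\<nu> * real n + 1) * (t powr \<nu>) ^ n)) sums (c * borel_transform \<nu> \<phi> t)"
    by (intro sums_mult borel_transform_sums assms)
  thus ?thesis
    using borel_transform_sums[of \<nu> "fps_const c * \<phi>" t] conv_radius_pos_mult[of "fps_const c" \<phi>] assms
    by (simp add: sums_iff mult.assoc)
qed

lemma borel_transform_add:
  assumes "\<nu> > 0" "fps_conv_radius \<phi> > 0" "fps_conv_radius \<psi> > 0"
  shows "borel_transform \<nu> (\<phi> + \<psi>) t = borel_transform \<nu> \<phi> t + borel_transform \<nu> \<psi> t"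
proof -
  have "(\<lambda>n. fps_nth \<phi> n / Gamma (\<nu> * real n + 1) * (t powr \<nu>) ^ n + fps_nth \<psi> n / Gamma (\<nu> * real n + 1) * (t powr \<nu>) ^ n)
     sums (borel_transform \<nu> \<phi> t + borel_transform \<nu> \<psi> t)"
    by (intro sums_add borel_transform_sums assms)
  thus ?thesis
    using borel_transform_sums[of \<nu> "\<phi> + \<psi>" t] conv_radius_pos_add[of \<phi> \<psi>] assms
    by (simp add: sums_iff add_divide_distrib distrib_right)
qed

lemma borel_transform_sum:
  assumes \<nu>: "\<nu> > 0" and "finite A" "\<And>x. x \<in> A \<Longrightarrow> fps_conv_radius (\<phi> x) > 0"
  shows "borel_transform \<nu> (\<Sum>x\<in>A. fps_const (c x) * \<phi> x) t = (\<Sum>x\<in>A. c x * borel_transform \<nu> (\<phi> x) t)"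
  using assms(2,3)
proof (induction A rule: finite_induct)
  case empty
  show ?case by (simp add: borel_transform_def borel_fps_def eval_fps_def)
next
  case (insert x A)
  have "fps_conv_radius (fps_const (c y) * \<phi> y) > 0" if "y \<in> insert x A" for y
    using insert.prems that by (intro conv_radius_pos_mult) auto
  hence "borel_transform \<nu> (fps_const (c x) * \<phi> x + (\<Sum>x\<in>A. fps_const (c x) * \<phi> x)) t =
     borel_transform \<nu> (fps_const (c x) * \<phi> x) t + borel_transform \<nu> (\<Sum>x\<in>A. fps_const (c x) * \<phi> x) t"
    by (intro borel_transform_add \<nu> conv_radius_pos_sum) auto
  thus ?case using insert by (simp add: borel_transform_cmult \<nu>)
qed

lemma borel_transform_1: "\<nu> > 0 \<Longrightarrow> borel_transform \<nu> 1 t = 1"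
proof -
  have "borel_fps \<nu> 1 = 1" by (rule fps_ext) simp
  thus ?thesis by (simp add: borel_transform_def)
qed

lemma powr_power_eq: "t > 0 \<Longrightarrow> (t powr \<nu>) ^ n = t powr (\<nu> * real n)" for t \<nu> :: real
  by (simp add: powr_powr flip: powr_realpow)

text \<open>The derivative is singular at \<open>0\<close> in general, so its series is stated with real exponents and for \<open>t > 0\<close> only.
  The factor \<open>\<nu> n\<close> produced by differentiation turns \<open>\<Gamma>(\<nu>n + 1)\<close> into \<open>\<Gamma>(\<nu>n)\<close>.\<close>

lemma borel_transform_deriv:
  assumes \<nu>: "\<nu> > 0" and \<phi>: "fps_conv_radius \<phi> > 0" and t: "t > 0"
  defines "D \<equiv> (\<lambda>t. \<Sum>n. fps_nth \<phi> (Suc n) / Gamma (\<nu> * real (Suc n)) * t powr (\<nu> * real (Suc n) - 1))"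
  shows "(borel_transform \<nu> \<phi> has_real_derivative D t) (at t)"
    and "(\<lambda>n. fps_nth \<phi> (Suc n) / Gamma (\<nu> * real (Suc n)) * t powr (\<nu> * real (Suc n) - 1)) sums D t"
proof -
  let ?F = "borel_fps \<nu> \<phi>"
  have R: "fps_conv_radius ?F = \<infinity>" using fps_conv_radius_borel_fps[OF \<nu> \<phi>] .
  have R': "fps_conv_radius (fps_deriv ?F) = \<infinity>"
    using fps_conv_radius_deriv[of ?F] unfolding R by (metis ereal_infty_less_eq(1))
  have "((\<lambda>t. eval_fps ?F (t powr \<nu>)) has_real_derivative eval_fps (fps_deriv ?F) (t powr \<nu>) * (\<nu> * t powr (\<nu> - 1))) (at t)"
    by (rule DERIV_chain2[OF has_field_derivative_eval_fps])
       (use t R in \<open>auto intro!: derivative_eq_intros\<close>)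
  moreover have S: "(\<lambda>n. fps_nth \<phi> (Suc n) / Gamma (\<nu> * real (Suc n)) * t powr (\<nu> * real (Suc n) - 1)) sums
     (eval_fps (fps_deriv ?F) (t powr \<nu>) * (\<nu> * t powr (\<nu> - 1)))"
  proof -
    have "(\<lambda>n. fps_nth (fps_deriv ?F) n * (t powr \<nu>) ^ n * (\<nu> * t powr (\<nu> - 1))) sums
     (eval_fps (fps_deriv ?F) (t powr \<nu>) * (\<nu> * t powr (\<nu> - 1)))"
      by (intro sums_mult2 sums_eval_fps) (simp add: R')
    moreover have "fps_nth (fps_deriv ?F) n * (t powr \<nu>) ^ n * (\<nu> * t powr (\<nu> - 1)) =
       fps_nth \<phi> (Suc n) / Gamma (\<nu> * real (Suc n)) * t powr (\<nu> * real (Suc n) - 1)" for n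
    proof -
      have "\<nu> * real (Suc n) > 0" using \<nu> by simp
      hence "Gamma (\<nu> * real (Suc n) + 1) = \<nu> * real (Suc n) * Gamma (\<nu> * real (Suc n))"
        by (intro Gamma_plus1) (auto elim: nonpos_Ints_cases)
      moreover have "Gamma (\<nu> * real (Suc n)) > 0" using \<nu> by (intro Gamma_real_pos) simp
      ultimately have "real (Suc n) * fps_nth ?F (Suc n) * \<nu> = fps_nth \<phi> (Suc n) / Gamma (\<nu> * real (Suc n))"
        using \<nu> by (simp add: field_simps del: of_nat_Suc)
      moreover have "(t powr \<nu>) ^ n * t powr (\<nu> - 1) = t powr (\<nu> * real (Suc n) - 1)"
        using t by (simp add: powr_power_eq powr_add[symmetric] algebra_simps)
      moreover have "fps_nth (fps_deriv ?F) n * (t powr \<nu>) ^ n * (\<nu> * t powr (\<nu> - 1)) =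
          (real (Suc n) * fps_nth ?F (Suc n) * \<nu>) * ((t powr \<nu>) ^ n * t powr (\<nu> - 1))"
        by (simp del: of_nat_Suc fps_nth_borel_fps add: mult_ac)
      ultimately show ?thesis by metis
    qed
    ultimately show ?thesis by simp
  qed
  moreover have "D t = eval_fps (fps_deriv ?F) (t powr \<nu>) * (\<nu> * t powr (\<nu> - 1))"
    unfolding D_def using S by (rule sums_unique[symmetric])
  ultimately show "(borel_transform \<nu> \<phi> has_real_derivative D t) (at t)"
     "(\<lambda>n. fps_nth \<phi> (Suc n) / Gamma (\<nu> * real (Suc n)) * t powr (\<nu> * real (Suc n) - 1)) sums D t"
    by (simp_all add: borel_transform_def[abs_def])
qed

section \<open>Laplace transforms and Caputo derivatives of the transform\<close>

text \<open>Both transforms below are computed term by term.  The building blocks \<open>g n\<close> are nonnegative, so that their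
  integrals can be evaluated as Lebesgue integrals without a separate integrability proof.\<close>

lemma has_bochner_integral_termwise:
  fixes g :: "nat \<Rightarrow> 'a \<Rightarrow> real" and c I :: "nat \<Rightarrow> real"
  assumes g: "\<And>n. g n \<in> borel_measurable M" "\<And>n x. g n x \<ge> 0"
    and I: "\<And>n. (\<integral>\<^sup>+x. ennreal (g n x) \<partial>M) = ennreal (I n)" "\<And>n. I n \<ge> 0"
    and pt: "\<And>x. summable (\<lambda>n. \<bar>c n\<bar> * g n x)"
    and sm: "summable (\<lambda>n. \<bar>c n\<bar> * I n)"
  shows "has_bochner_integral M (\<lambda>x. \<Sum>n. c n * g n x) (\<Sum>n. c n * I n)"
proof -
  have hb: "has_bochner_integral M (g n) (I n)" for n
    using g I by (intro has_bochner_integral_nn_integral) auto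
  have int: "integrable M (\<lambda>x. c n * g n x)" for n
    using hb[of n] by (auto simp: has_bochner_integral_iff)
  have nrm: "(\<integral>x. norm (c n * g n x) \<partial>M) = \<bar>c n\<bar> * I n" for n
    using hb[of n] g(2) by (auto simp: has_bochner_integral_iff abs_mult)
  have pt': "AE x in M. summable (\<lambda>n. norm (c n * g n x))"
    using pt g(2) by (auto simp: abs_mult)
  have sm': "summable (\<lambda>n. \<integral>x. norm (c n * g n x) \<partial>M)"
    using sm by (simp only: nrm)
  have "(\<Sum>n. c n * I n) = (\<Sum>n. \<integral>x. c n * g n x \<partial>M)"
    using hb by (auto simp: has_bochner_integral_iff)
  thus ?thesis
    using integrable_suminf[OF int pt' sm'] integral_suminf[OF int pt' sm']
    by (simp add: has_bochner_integral_iff)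
qed

text \<open>Absolute convergence of the transformed series is obtained by applying convergence to the series of
  absolute values.\<close>

lemma fps_conv_radius_abs:
  "fps_conv_radius (Abs_fps (\<lambda>n. \<bar>fps_nth \<phi> n\<bar>)) = fps_conv_radius (\<phi> :: real fps)"
  by (simp add: fps_conv_radius_def conv_radius_def)

lemma nn_integral_powr_exp:
  fixes x l :: real
  assumes "x > -1" "l > 0"
  shows "(\<integral>\<^sup>+t. ennreal (indicator {0<..} t * (t powr x * exp (- l * t))) \<partial>lborel) = ennreal (Gamma (x + 1) / l powr (x + 1))"
proof -
  have "ennreal (Gamma (x + 1)) = (\<integral>\<^sup>+t. ennreal (indicator {0..} t * t powr (x + 1 - 1) / exp t) \<partial>lborel)"
    using assms by (intro Gamma_conv_nn_integral_real) simp
  also have "\<dots> = (\<integral>\<^sup>+t. ennreal (indicator {0<..} t * (t powr x * exp (- t))) \<partial>lborel)"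
    by (intro nn_integral_cong) (auto simp: indicator_def exp_minus field_simps)
  also have "\<dots> = ennreal \<bar>l\<bar> * (\<integral>\<^sup>+t. ennreal (indicator {0<..} (0 + l * t) * ((0 + l * t) powr x * exp (- (0 + l * t)))) \<partial>lborel)"
    using assms by (intro nn_integral_real_affine) auto
  also have "\<dots> = ennreal \<bar>l\<bar> * (\<integral>\<^sup>+t. ennreal (l powr x) * ennreal (indicator {0<..} t * (t powr x * exp (- l * t))) \<partial>lborel)"
    using assms by (intro arg_cong[where f="\<lambda>z. ennreal \<bar>l\<bar> * z"] nn_integral_cong)
      (auto simp: indicator_def zero_less_mult_iff powr_mult mult_ac ennreal_mult[symmetric])
  also have "\<dots> = ennreal \<bar>l\<bar> * (ennreal (l powr x) * (\<integral>\<^sup>+t. ennreal (indicator {0<..} t * (t powr x * exp (- l * t))) \<partial>lborel))"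
    by (subst nn_integral_cmult) auto
  also have "\<dots> = (ennreal \<bar>l\<bar> * ennreal (l powr x)) * (\<integral>\<^sup>+t. ennreal (indicator {0<..} t * (t powr x * exp (- l * t))) \<partial>lborel)"
    by (simp only: mult.assoc)
  also have "ennreal \<bar>l\<bar> * ennreal (l powr x) = ennreal (l powr (x + 1))"
    using assms by (simp add: ennreal_mult[symmetric] powr_add mult.commute)
  finally have *: "ennreal (Gamma (x + 1)) = ennreal (l powr (x + 1)) *
      (\<integral>\<^sup>+t. ennreal (indicator {0<..} t * (t powr x * exp (- l * t))) \<partial>lborel)" .
  let ?I = "(\<integral>\<^sup>+t. ennreal (indicator {0<..} t * (t powr x * exp (- l * t))) \<partial>lborel)"
  have "ennreal (Gamma (x + 1) / l powr (x + 1)) = ennreal (1 / l powr (x + 1)) * ennreal (Gamma (x + 1))"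
    using assms by (subst ennreal_mult[symmetric]) (auto intro: less_imp_le[OF Gamma_real_pos])
  also have "\<dots> = (ennreal (1 / l powr (x + 1)) * ennreal (l powr (x + 1))) * ?I"
    unfolding * by (simp add: mult.assoc)
  also have "ennreal (1 / l powr (x + 1)) * ennreal (l powr (x + 1)) = 1"
    using assms by (subst ennreal_mult[symmetric]) auto
  finally show ?thesis by simp
qed


text \<open>The Laplace transform of \<open>t\<^bsup>\<nu>n\<^esup> / \<Gamma>(\<nu>n + 1)\<close> is \<open>\<lambda>\<^bsup>-\<nu>n-1\<^esup>\<close>, so summation reproduces the original series.\<close>

lemma laplace_borel_transform:
  assumes \<nu>: "\<nu> > 0" and l: "l > 0" and r: "ereal (l powr (- \<nu>)) < fps_conv_radius \<phi>"
  shows "has_bochner_integral lborel (\<lambda>t. indicator {0<..} t * (exp (- l * t) * borel_transform \<nu> \<phi> t))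
     (eval_fps \<phi> (l powr (- \<nu>)) / l)"
proof -
  have \<phi>: "fps_conv_radius \<phi> > 0"
    by (rule le_less_trans[OF _ r]) (simp add: zero_ereal_def)
  let ?\<psi> = "Abs_fps (\<lambda>n. \<bar>fps_nth \<phi> n\<bar>)"
  have \<psi>: "fps_conv_radius ?\<psi> > 0" using \<phi> by (simp only: fps_conv_radius_abs)
  define c where "c n = fps_nth \<phi> n / Gamma (\<nu> * real n + 1)" for n
  define g where "g n t = indicator {0<..} t * (t powr (\<nu> * real n) * exp (- l * t))" for n and t :: real
  define I where "I n = Gamma (\<nu> * real n + 1) / l powr (\<nu> * real n + 1)" for n
  have G: "Gamma (\<nu> * real n + 1) > 0" for n using \<nu> by (intro Gamma_real_pos) (simp add: add_nonneg_pos)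
  have cI: "c n * I n = fps_nth \<phi> n * (l powr (- \<nu>)) ^ n / l" for n
    using G[of n] l by (simp add: c_def I_def powr_add powr_power_eq powr_minus field_simps)
  have "has_bochner_integral lborel (\<lambda>t. \<Sum>n. c n * g n t) (\<Sum>n. c n * I n)"
  proof (rule has_bochner_integral_termwise)
    show "g n \<in> borel_measurable lborel" for n by (simp add: g_def[abs_def])
    show "g n t \<ge> 0" for n t by (simp add: g_def)
    show "(\<integral>\<^sup>+t. ennreal (g n t) \<partial>lborel) = ennreal (I n)" for n
    proof -
      have "0 \<le> \<nu> * real n" using \<nu> by simp
      hence "- 1 < \<nu> * real n" by linarith
      thus ?thesis unfolding g_def I_def using l by (rule nn_integral_powr_exp)
    qed
    show "I n \<ge> 0" for n using G[of n] by (simp add: I_def)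
    show "summable (\<lambda>n. \<bar>c n\<bar> * g n t)" for t
    proof (cases "t > 0")
      case True
      have "summable (\<lambda>n. exp (- l * t) * (\<bar>fps_nth \<phi> n\<bar> / Gamma (\<nu> * real n + 1) * (t powr \<nu>) ^ n))"
        using borel_transform_sums[OF \<nu> \<psi>, of t] by (intro summable_mult) (simp add: sums_iff)
      moreover have "exp (- l * t) * (\<bar>fps_nth \<phi> n\<bar> / Gamma (\<nu> * real n + 1) * (t powr \<nu>) ^ n) = \<bar>c n\<bar> * g n t" for n
        using True G[of n] by (simp add: c_def g_def powr_power_eq)
      ultimately show ?thesis by simp
    qed (simp add: g_def)
    have "summable (\<lambda>n. norm (fps_nth \<phi> n * (l powr (- \<nu>)) ^ n) / l)"
      using r by (intro summable_divide norm_summable_fps) auto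
    moreover have "norm (fps_nth \<phi> n * (l powr (- \<nu>)) ^ n) / l = \<bar>c n\<bar> * I n" for n
      using arg_cong[OF cI[of n], of abs] l \<open>\<And>n. I n \<ge> 0\<close>[of n] by (simp add: abs_mult)
    ultimately show "summable (\<lambda>n. \<bar>c n\<bar> * I n)" by (simp only:)
  qed
  moreover have "(\<Sum>n. c n * I n) = eval_fps \<phi> (l powr (- \<nu>)) / l"
    unfolding cI eval_fps_def using r by (intro suminf_divide summable_fps) simp
  moreover have "(\<Sum>n. c n * g n t) = indicator {0<..} t * (exp (- l * t) * borel_transform \<nu> \<phi> t)" for t
  proof (cases "t > 0")
    case True
    have "(\<lambda>n. exp (- l * t) * (fps_nth \<phi> n / Gamma (\<nu> * real n + 1) * (t powr \<nu>) ^ n)) sums (exp (- l * t) * borel_transform \<nu> \<phi> t)"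
      by (intro sums_mult borel_transform_sums \<nu> \<phi>)
    moreover have "exp (- l * t) * (fps_nth \<phi> n / Gamma (\<nu> * real n + 1) * (t powr \<nu>) ^ n) = c n * g n t" for n
      using True by (simp add: c_def g_def powr_power_eq)
    ultimately show ?thesis using True by (simp add: sums_iff)
  qed (simp add: g_def)
  ultimately show ?thesis by simp
qed


lemma nn_integral_Beta_interval:
  fixes a b t :: real
  assumes "a > 0" "b > 0" "t > 0"
  shows "(\<integral>\<^sup>+s. ennreal (indicator {0<..<t} s * (s powr (a - 1) * (t - s) powr (b - 1))) \<partial>lborel)
     = ennreal (t powr (a + b - 1) * Beta a b)"
proof -
  have B: "(\<integral>\<^sup>+u. ennreal (indicator {0..1} u * (u powr (a - 1) * (1 - u) powr (b - 1))) \<partial>lborel) = ennreal (Beta a b)"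
    by (rule nn_integral_has_integral_lebesgue[OF _ has_integral_Beta_real]) (use assms in auto)
  have "(\<integral>\<^sup>+s. ennreal (indicator {0<..<t} s * (s powr (a - 1) * (t - s) powr (b - 1))) \<partial>lborel)
     = ennreal \<bar>t\<bar> * (\<integral>\<^sup>+u. ennreal (indicator {0<..<t} (0 + t * u) * ((0 + t * u) powr (a - 1) * (t - (0 + t * u)) powr (b - 1))) \<partial>lborel)"
    using assms by (intro nn_integral_real_affine) auto
  also have "(\<integral>\<^sup>+u. ennreal (indicator {0<..<t} (0 + t * u) * ((0 + t * u) powr (a - 1) * (t - (0 + t * u)) powr (b - 1))) \<partial>lborel)
     = (\<integral>\<^sup>+u. ennreal (t powr (a + b - 2)) * ennreal (indicator {0..1} u * (u powr (a - 1) * (1 - u) powr (b - 1))) \<partial>lborel)"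
  proof (intro nn_integral_cong)
    fix u :: real
    have "(t - t * u) powr (b - 1) = t powr (b - 1) * (1 - u) powr (b - 1)" if "0 < u" "u < 1"
      using assms that powr_mult[of t "1 - u" "b - 1"] by (simp only: right_diff_distrib mult_1_right)
    moreover have "(t * u) powr (a - 1) = t powr (a - 1) * u powr (a - 1)" if "0 < u"
      by (rule powr_mult)
    moreover have "t powr (a - 1) * t powr (b - 1) = t powr (a + b - 2)"
      by (simp add: powr_add[symmetric])
    ultimately have "indicator {0<..<t} (0 + t * u) * ((0 + t * u) powr (a - 1) * (t - (0 + t * u)) powr (b - 1))
       = t powr (a + b - 2) * (indicator {0..1} u * (u powr (a - 1) * (1 - u) powr (b - 1)))"
      using assms by (auto simp: indicator_def zero_less_mult_iff)
    thus "ennreal (indicator {0<..<t} (0 + t * u) * ((0 + t * u) powr (a - 1) * (t - (0 + t * u)) powr (b - 1)))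
       = ennreal (t powr (a + b - 2)) * ennreal (indicator {0..1} u * (u powr (a - 1) * (1 - u) powr (b - 1)))"
      by (simp add: ennreal_mult[symmetric])
  qed
  also have "\<dots> = ennreal (t powr (a + b - 2)) * ennreal (Beta a b)"
    by (subst nn_integral_cmult) (auto simp: B)
  also have "ennreal \<bar>t\<bar> * \<dots> = ennreal (t powr (a + b - 1) * Beta a b)"
  proof -
    have "t * t powr (a + b - 2) = t powr (a + b - 1)"
      using assms powr_add[of t 1 "a + b - 2"] by simp
    moreover have "Beta a b \<ge> 0" using assms by (simp add: Beta_def Gamma_real_nonneg)
    ultimately show ?thesis using assms by (simp add: ennreal_mult[symmetric] mult.assoc[symmetric])
  qed
  finally show ?thesis .
qed

text \<open>By the Beta integral, the Caputo derivative of order \<open>j \<nu>\<close> sends the image of \<open>x\<^sup>n\<close> to the image of \<open>x\<^bsup>n-j\<^esup>\<close>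
  for \<open>n \<ge> 1\<close> and to \<open>0\<close> for \<open>n = 0\<close>.  The vanishing of \<open>a\<^sub>1, \<dots>, a\<^bsub>j-1\<^esub>\<close> excludes the singular
  terms \<open>t\<^bsup>\<nu>(n-j)\<^esup>\<close> with \<open>n < j\<close>, which are not images of power series.\<close>

lemma caputo_borel_transform:
  assumes \<nu>: "\<nu> > 0" and j: "j \<ge> 1" "real j * \<nu> \<le> 1" and \<phi>: "fps_conv_radius \<phi> > 0"
    and z: "\<And>n. 1 \<le> n \<Longrightarrow> n < j \<Longrightarrow> fps_nth \<phi> n = 0" and t: "t > 0"
  shows "caputo_differentiable (real j * \<nu>) (borel_transform \<nu> \<phi>) t"
    and "caputo_deriv (real j * \<nu>) (borel_transform \<nu> \<phi>) t = borel_transform \<nu> (fps_shift j \<phi>) t"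
proof -
  define \<beta> where "\<beta> = real j * \<nu>"
  define D where "D t = (\<Sum>n. fps_nth \<phi> (Suc n) / Gamma (\<nu> * real (Suc n)) * t powr (\<nu> * real (Suc n) - 1))" for t
  have deriv: "(borel_transform \<nu> \<phi> has_real_derivative D s) (at s)" if "s > 0" for s
    unfolding D_def by (rule borel_transform_deriv(1)[OF \<nu> \<phi> that])
  have Dsums: "(\<lambda>n. fps_nth \<phi> (Suc n) / Gamma (\<nu> * real (Suc n)) * s powr (\<nu> * real (Suc n) - 1)) sums D s" if "s > 0" for s
    unfolding D_def by (rule borel_transform_deriv(2)[OF \<nu> \<phi> that])
  have \<beta>: "0 < \<beta>" "\<beta> \<le> 1" using \<nu> j by (auto simp: \<beta>_def)
  \<comment> \<open>stated for arbitrary series, since it is applied both to \<open>\<phi>\<close> and to its series of absolute values\<close>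
  have shift: "(\<lambda>n. fps_nth \<phi> (Suc n) * (t powr (\<nu> * real (Suc n) - \<beta>) / Gamma (\<nu> * real (Suc n) + 1 - \<beta>)))
     sums borel_transform \<nu> (fps_shift j \<phi>) t" (is "?f sums _")
    if z: "\<And>n. 1 \<le> n \<Longrightarrow> n < j \<Longrightarrow> fps_nth \<phi> n = 0" and \<phi>: "fps_conv_radius \<phi> > 0" for \<phi>
  proof -
    have "(\<lambda>n. fps_nth (fps_shift j \<phi>) n / Gamma (\<nu> * real n + 1) * (t powr \<nu>) ^ n) sums borel_transform \<nu> (fps_shift j \<phi>) t"
      using \<nu> \<phi> by (intro borel_transform_sums) auto
    moreover have "fps_nth (fps_shift j \<phi>) n / Gamma (\<nu> * real n + 1) * (t powr \<nu>) ^ n =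
       fps_nth \<phi> (Suc (n + (j - 1))) * (t powr (\<nu> * real (Suc (n + (j - 1))) - \<beta>) / Gamma (\<nu> * real (Suc (n + (j - 1))) + 1 - \<beta>))" for n
    proof -
      have e: "Suc (n + (j - 1)) = n + j" using j by simp
      have e2: "\<nu> * real (n + j) - \<beta> = \<nu> * real n" by (simp add: \<beta>_def algebra_simps)
      have e3: "\<nu> * real (n + j) + 1 - \<beta> = \<nu> * real n + 1" by (simp add: \<beta>_def algebra_simps)
      show ?thesis unfolding e e2 e3 using t by (simp add: powr_power_eq)
    qed
    ultimately have "(\<lambda>n. ?f (n + (j - 1))) sums borel_transform \<nu> (fps_shift j \<phi>) t" by simp
    hence "?f sums (borel_transform \<nu> (fps_shift j \<phi>) t + (\<Sum>n<j - 1. ?f n))"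
      by (subst (asm) sums_iff_shift) 
    moreover have "(\<Sum>n<j - 1. ?f n) = 0" using z by (intro sum.neutral) auto
    ultimately show ?thesis by simp
  qed
  have "caputo_differentiable \<beta> (borel_transform \<nu> \<phi>) t \<and>
     caputo_deriv \<beta> (borel_transform \<nu> \<phi>) t = borel_transform \<nu> (fps_shift j \<phi>) t"
  proof (cases "\<beta> = 1")
    case True
    have "borel_transform \<nu> (fps_shift j \<phi>) t = D t"
      using shift[OF z \<phi>] Dsums[OF t] unfolding True by (simp add: sums_iff mult.commute)
    thus ?thesis using True deriv[OF t]
      by (auto simp: caputo_differentiable_def caputo_deriv_def DERIV_imp_deriv real_differentiable_def)
  next
    case False
    define b where "b = 1 - \<beta>"
    have b: "b > 0" using \<beta> False by (simp add: b_def)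
    let ?\<psi> = "Abs_fps (\<lambda>n. \<bar>fps_nth \<phi> n\<bar>)"
    have \<psi>: "fps_conv_radius ?\<psi> > 0" using \<phi> by (simp only: fps_conv_radius_abs)
    define c where "c n = fps_nth \<phi> (Suc n) / Gamma (\<nu> * real (Suc n))" for n
    define g where "g n s = indicator {0<..<t} s * (s powr (\<nu> * real (Suc n) - 1) * (t - s) powr (b - 1))" for n s
    define I where "I n = t powr (\<nu> * real (Suc n) + b - 1) * Beta (\<nu> * real (Suc n)) b" for n
    have G: "Gamma (\<nu> * real (Suc n)) > 0" "Gamma (\<nu> * real (Suc n) + b) > 0" "Gamma b > 0" for n
      using \<nu> b by (auto intro!: Gamma_real_pos add_pos_pos mult_pos_pos simp del: of_nat_Suc)
    have cI: "c n * I n = Gamma b * (fps_nth \<phi> (Suc n) * (t powr (\<nu> * real (Suc n) - \<beta>) / Gamma (\<nu> * real (Suc n) + 1 - \<beta>)))" for n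
      using G(1)[of n] by (simp add: c_def I_def Beta_def b_def algebra_simps del: of_nat_Suc)
    have hb: "has_bochner_integral lborel (\<lambda>s. \<Sum>n. c n * g n s) (\<Sum>n. c n * I n)"
    proof (rule has_bochner_integral_termwise)
      show "g n \<in> borel_measurable lborel" for n by (simp add: g_def[abs_def])
      show "g n s \<ge> 0" for n s by (simp add: g_def)
      show "(\<integral>\<^sup>+s. ennreal (g n s) \<partial>lborel) = ennreal (I n)" for n
        unfolding g_def I_def using \<nu> b t by (intro nn_integral_Beta_interval) (auto simp del: of_nat_Suc)
      show Inn: "I n \<ge> 0" for n using G(1)[of n] G(2)[of n] G(3) by (simp add: I_def Beta_def del: of_nat_Suc)
      show "summable (\<lambda>n. \<bar>c n\<bar> * g n s)" for s
      proof (cases "s \<in> {0<..<t}")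
        case True
        hence "summable (\<lambda>n. \<bar>fps_nth \<phi> (Suc n)\<bar> / Gamma (\<nu> * real (Suc n)) * s powr (\<nu> * real (Suc n) - 1))"
          using borel_transform_deriv(2)[OF \<nu> \<psi>, where t = s] by (simp add: sums_iff)
        hence "summable (\<lambda>n. \<bar>fps_nth \<phi> (Suc n)\<bar> / Gamma (\<nu> * real (Suc n)) * s powr (\<nu> * real (Suc n) - 1) * (t - s) powr (b - 1))"
          by (rule summable_mult2)
        moreover have "\<bar>fps_nth \<phi> (Suc n)\<bar> / Gamma (\<nu> * real (Suc n)) * s powr (\<nu> * real (Suc n) - 1) * (t - s) powr (b - 1) = \<bar>c n\<bar> * g n s" for n
          using True G(1)[of n] by (simp add: c_def g_def del: of_nat_Suc)
        ultimately show ?thesis by simp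
      qed (simp add: g_def)
      have "summable (\<lambda>n. Gamma b * (\<bar>fps_nth \<phi> (Suc n)\<bar> * (t powr (\<nu> * real (Suc n) - \<beta>) / Gamma (\<nu> * real (Suc n) + 1 - \<beta>))))"
        using shift[OF _ \<psi>] z by (intro summable_mult) (simp add: sums_iff)
      moreover have "Gamma b * (\<bar>fps_nth \<phi> (Suc n)\<bar> * (t powr (\<nu> * real (Suc n) - \<beta>) / Gamma (\<nu> * real (Suc n) + 1 - \<beta>))) = \<bar>c n\<bar> * I n" for n
      proof -
        have "\<bar>c n\<bar> * I n = \<bar>c n * I n\<bar>" using Inn[of n] by (simp add: abs_mult)
        moreover have "Gamma (\<nu> * real (Suc n) + 1 - \<beta>) > 0" using G(2)[of n] by (simp add: b_def add_diff_eq)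
        ultimately show ?thesis using G(3) unfolding cI by (simp add: abs_mult del: of_nat_Suc)
      qed
      ultimately show "summable (\<lambda>n. \<bar>c n\<bar> * I n)" by simp
    qed
    have eq: "(\<Sum>n. c n * g n s) = indicator {0<..<t} s *\<^sub>R (deriv (borel_transform \<nu> \<phi>) s / (t - s) powr \<beta>)" for s
    proof (cases "s \<in> {0<..<t}")
      case True
      have "(\<lambda>n. c n * s powr (\<nu> * real (Suc n) - 1) * (t - s) powr (b - 1)) sums (D s * (t - s) powr (b - 1))"
        unfolding c_def using True by (intro sums_mult2 Dsums) auto
      moreover have "c n * s powr (\<nu> * real (Suc n) - 1) * (t - s) powr (b - 1) = c n * g n s" for n
        using True by (simp add: g_def)
      moreover have "deriv (borel_transform \<nu> \<phi>) s = D s" using True by (intro DERIV_imp_deriv deriv) auto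
      moreover have "(t - s) powr (b - 1) = 1 / (t - s) powr \<beta>" by (simp add: b_def powr_minus_divide)
      ultimately show ?thesis using True by (simp add: sums_iff)
    qed (simp add: g_def)
    have "set_integrable lborel {0<..<t} (\<lambda>s. deriv (borel_transform \<nu> \<phi>) s / (t - s) powr \<beta>)"
      using hb unfolding eq has_bochner_integral_iff set_integrable_def by simp
    moreover have "\<forall>s\<in>{0<..<t}. borel_transform \<nu> \<phi> differentiable (at s)"
      using deriv by (metis greaterThanLessThan_iff real_differentiable_def)
    moreover have "(LBINT s:{0<..<t}. deriv (borel_transform \<nu> \<phi>) s / (t - s) powr \<beta>) = (\<Sum>n. c n * I n)"
      using hb unfolding eq has_bochner_integral_iff set_lebesgue_integral_def by simp
    moreover have "(\<lambda>n. c n * I n) sums (Gamma b * borel_transform \<nu> (fps_shift j \<phi>) t)"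
      unfolding cI by (intro sums_mult shift z \<phi>)
    ultimately show ?thesis
      using False G(3) by (simp add: caputo_differentiable_def caputo_deriv_def sums_iff b_def)
  qed
  thus "caputo_differentiable (real j * \<nu>) (borel_transform \<nu> \<phi>) t"
    and "caputo_deriv (real j * \<nu>) (borel_transform \<nu> \<phi>) t = borel_transform \<nu> (fps_shift j \<phi>) t"
    by (simp_all add: \<beta>_def)
qed

section \<open>The multivariate Mittag-Leffler function\<close>

text \<open>The multi-indices over which the Mittag-Leffler series runs are the count functions of multisets, which index the
  coefficients of a finite product of power series.\<close>

lemma bij_betw_multisets_of_size_PiE:
  assumes A: "finite A"
  shows "bij_betw (\<lambda>X. restrict (count X) A) (multisets_of_size A n) {k \<in> A \<rightarrow>\<^sub>E UNIV. sum k A = n}"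
proof (rule bij_betwI[where g = "\<lambda>k. \<Sum>x\<in>A. replicate_mset (k x) x"])
  have cnt: "count (\<Sum>x\<in>A. replicate_mset (k x) x) y = (if y \<in> A then k y else 0)" for k :: "'a \<Rightarrow> nat" and y
    using A by (simp add: count_sum)
  show "(\<lambda>X. restrict (count X) A) \<in> multisets_of_size A n \<rightarrow> {k \<in> A \<rightarrow>\<^sub>E UNIV. sum k A = n}"
  proof
    fix X assume X: "X \<in> multisets_of_size A n"
    have "sum (count X) A = size X"
      unfolding size_multiset_overloaded_eq using A X
      by (intro sum.mono_neutral_right) (auto simp: multisets_of_size_def not_in_iff)
    thus "restrict (count X) A \<in> {k \<in> A \<rightarrow>\<^sub>E UNIV. sum k A = n}"
      using X by (auto simp: multisets_of_size_def)
  qed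
  show "(\<lambda>k. \<Sum>x\<in>A. replicate_mset (k x) x) \<in> {k \<in> A \<rightarrow>\<^sub>E UNIV. sum k A = n} \<rightarrow> multisets_of_size A n"
  proof
    fix k :: "'a \<Rightarrow> nat" assume k: "k \<in> {k \<in> A \<rightarrow>\<^sub>E UNIV. sum k A = n}"
    have "set_mset (\<Sum>x\<in>A. replicate_mset (k x) x) \<subseteq> A"
    proof
      fix y assume "y \<in># (\<Sum>x\<in>A. replicate_mset (k x) x)"
      hence "count (\<Sum>x\<in>A. replicate_mset (k x) x) y > 0" by (simp only: count_greater_zero_iff)
      thus "y \<in> A" unfolding cnt by (simp split: if_splits)
    qed
    moreover have "size (\<Sum>x\<in>A. replicate_mset (k x) x) = n"
      using k unfolding size_multiset_sum by simp
    ultimately show "(\<Sum>x\<in>A. replicate_mset (k x) x) \<in> multisets_of_size A n"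
      by (simp add: multisets_of_size_def)
  qed
  show "(\<Sum>x\<in>A. replicate_mset (restrict (count X) A x) x) = X" if "X \<in> multisets_of_size A n" for X
    by (rule multiset_eqI, unfold cnt) (use that in \<open>auto simp: multisets_of_size_def not_in_iff\<close>)
  show "restrict (count (\<Sum>x\<in>A. replicate_mset (k x) x)) A = k" if "k \<in> {k \<in> A \<rightarrow>\<^sub>E UNIV. sum k A = n}" for k
    using that unfolding cnt by (auto simp: PiE_def extensional_def restrict_def fun_eq_iff)
qed

lemma fps_prod_nth_PiE:
  fixes f :: "'a \<Rightarrow> 'b :: comm_ring_1 fps"
  assumes A: "finite A"
  shows "finite {k \<in> A \<rightarrow>\<^sub>E UNIV. sum k A = n}"
    and "fps_nth (\<Prod>x\<in>A. f x) n = (\<Sum>k\<in>{k \<in> A \<rightarrow>\<^sub>E UNIV. sum k A = n}. \<Prod>x\<in>A. fps_nth (f x) (k x))"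
proof -
  note bij = bij_betw_multisets_of_size_PiE[OF A, of n]
  show "finite {k \<in> A \<rightarrow>\<^sub>E UNIV. sum k A = n}"
    using bij_betw_finite[OF bij] finite_multisets_of_size[OF A] by blast
  have "fps_nth (\<Prod>x\<in>A. f x) n = (\<Sum>X\<in>multisets_of_size A n. \<Prod>x\<in>A. fps_nth (f x) (restrict (count X) A x))"
    unfolding fps_prod_nth'[OF A] by (intro sum.cong prod.cong) auto
  also have "\<dots> = (\<Sum>k\<in>{k \<in> A \<rightarrow>\<^sub>E UNIV. sum k A = n}. \<Prod>x\<in>A. fps_nth (f x) (k x))"
    by (rule sum.reindex_bij_betw[OF bij])
  finally show "fps_nth (\<Prod>x\<in>A. f x) n = \<dots>" .
qed

lemma fps_nth_inverse_linear_power: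
  fixes c :: real
  assumes "g > 0"
  shows "fps_nth (inverse ((1 - fps_const c * fps_X) ^ g)) n = pochhammer (real g) n / fact n * c ^ n"
proof -
  have "real ((g + n - 1) choose n) = pochhammer (real g) n / fact n"
  proof -
    have "real (g + n - 1) - real n + 1 = real g" using assms by (cases g) auto
    thus ?thesis
      unfolding binomial_gbinomial gbinomial_pochhammer' by (simp only:)
  qed
  thus ?thesis unfolding one_minus_const_fps_X_neg_power'[OF assms] by simp
qed

text \<open>The Gamma factor depends on a multi-index only through its total degree.  Grouping by total degree therefore
  leaves the coefficients of \<open>\<Prod>\<^sub>i (1 - \<eta>\<^sub>i x)\<^bsup>-g\<^sub>i\<^esup>\<close>.  The rearrangement is justified by the same computation for
  \<open>\<bar>\<eta>\<^sub>i\<bar>\<close> in place of \<open>\<eta>\<^sub>i\<close>, which dominates the series termwise because Pochhammer symbols are nonnegative.\<close>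

lemma mittag_leffler_eq_borel_transform:
  fixes \<eta> :: "nat \<Rightarrow> real" and g :: "nat \<Rightarrow> nat"
  assumes \<nu>: "\<nu> > 0" and g: "\<And>i. i \<in> {1..M} \<Longrightarrow> g i > 0" and t: "t \<ge> 0"
  shows "rpow t (\<nu> * real d) * mittag_leffler \<nu> (\<nu> * real d + 1) M (\<lambda>i. real (g i)) (\<lambda>i. \<eta> i * rpow t \<nu>)
    = borel_transform \<nu> (fps_X ^ d * (\<Prod>i=1..M. inverse ((1 - fps_const (\<eta> i) * fps_X) ^ g i))) t"
proof -
  define y where "y = t powr \<nu>"
  have y: "y \<ge> 0" by (simp add: y_def)
  have yd: "rpow t (\<nu> * real d) = y ^ d"
  proof (cases "t = 0")
    case True thus ?thesis using \<nu> by (cases d) (auto simp: rpow_def y_def)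
  next
    case False
    thus ?thesis using t \<nu> by (auto simp: rpow_def y_def powr_powr simp flip: powr_realpow)
  qed
  have y1: "rpow t \<nu> = y" using \<nu> by (simp add: rpow_def y_def)
  define K where "K = {1..M} \<rightarrow>\<^sub>E (UNIV :: nat set)"
  define Kn where "Kn n = {k \<in> K. sum k {1..M} = n}" for n
  define w where "w \<eta> i = inverse ((1 - fps_const (\<eta> i) * fps_X) ^ g i)" for \<eta> :: "nat \<Rightarrow> real" and i
  define W where "W \<eta> = (\<Prod>i=1..M. w \<eta> i)" for \<eta>
  \<comment> \<open>the factor \<open>y\<^sup>d\<close> is kept inside the terms because it may vanish (at \<open>t = 0\<close>) and cannot be divided out\<close>
  define F where "F \<eta> k = y ^ d * ((\<Prod>j=1..M. fps_nth (w \<eta> j) (k j)) * y ^ (sum k {1..M}) / Gamma (\<nu> * real (sum k {1..M} + d) + 1))" for \<eta> k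
  define G where "G \<eta> n = y ^ d * (fps_nth (W \<eta>) n * y ^ n / Gamma (\<nu> * real (n + d) + 1))" for \<eta> n
  have Gam: "Gamma (\<nu> * real n + 1) > 0" for n using \<nu> by (intro Gamma_real_pos) (simp add: add_nonneg_pos)
  have wn: "fps_nth (w \<eta> i) n = pochhammer (real (g i)) n / fact n * \<eta> i ^ n" if "i \<in> {1..M}" for \<eta> i n
    using fps_nth_inverse_linear_power[OF g[OF that]] by (simp add: w_def)
  have rad: "fps_conv_radius (W \<eta>) > 0" for \<eta>
    unfolding W_def
  proof (rule conv_radius_pos_prod)
    fix i
    have "fps_conv_radius ((1 - fps_const (\<eta> i) * fps_X) ^ g i :: real fps) \<ge> fps_conv_radius (1 - fps_const (\<eta> i) * fps_X :: real fps)"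
      by (rule fps_conv_radius_power)
    moreover have "fps_conv_radius (1 - fps_const (\<eta> i) * fps_X :: real fps) \<ge> \<infinity>"
      using fps_conv_radius_diff[of 1 "fps_const (\<eta> i) * fps_X :: real fps"] fps_conv_radius_mult[of "fps_const (\<eta> i)" "fps_X :: real fps"]
      by simp
    ultimately show "fps_conv_radius (w \<eta> i) > 0"
      unfolding w_def by (intro fps_conv_radius_inverse_pos) (auto simp: fps_power_zeroth)
  qed
  have fiber: "(F \<eta> has_sum G \<eta> n) (Kn n)" for \<eta> n
  proof -
    have "G \<eta> n = sum (F \<eta>) (Kn n)"
      unfolding G_def W_def fps_prod_nth_PiE(2)[OF finite_atLeastAtMost] sum_distrib_left sum_distrib_right sum_divide_distrib Kn_def K_def F_def
      by (intro sum.cong) auto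
    moreover have "finite (Kn n)" unfolding Kn_def K_def by (intro fps_prod_nth_PiE(1)) simp
    ultimately show ?thesis using has_sum_finite[of "Kn n" "F \<eta>"] by simp
  qed
  have Gsums: "G \<eta> sums borel_transform \<nu> (fps_X ^ d * W \<eta>) t" for \<eta>
  proof -
    have "0 < min (fps_conv_radius (fps_X ^ d :: real fps)) (fps_conv_radius (W \<eta>))" using rad by simp
    also have "\<dots> \<le> fps_conv_radius (fps_X ^ d * W \<eta>)" by (rule fps_conv_radius_mult)
    finally have "(\<lambda>n. fps_nth (fps_X ^ d * W \<eta>) n / Gamma (\<nu> * real n + 1) * y ^ n) sums borel_transform \<nu> (fps_X ^ d * W \<eta>) t" (is "?f sums ?S")
      unfolding y_def by (intro borel_transform_sums \<nu>)
    hence "(\<lambda>n. ?f (n + d)) sums (?S - (\<Sum>n<d. ?f n))" by (rule sums_split_initial_segment)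
    moreover have "(\<Sum>n<d. ?f n) = 0" by (intro sum.neutral) (simp add: fps_X_power_mult_nth)
    moreover have "?f (n + d) = G \<eta> n" for n by (simp add: G_def fps_X_power_mult_nth power_add)
    ultimately show ?thesis by simp
  qed
  have nrm: "norm (F \<eta> k) = F (\<lambda>i. \<bar>\<eta> i\<bar>) k" for \<eta> k
  proof -
    have pn: "pochhammer (real a) n \<ge> 0" for a n
      unfolding pochhammer_of_nat by simp
    have "\<bar>\<Prod>j=1..M. fps_nth (w \<eta> j) (k j)\<bar> = (\<Prod>j=1..M. fps_nth (w (\<lambda>i. \<bar>\<eta> i\<bar>) j) (k j))"
      unfolding abs_prod by (intro prod.cong) (auto simp: wn abs_mult power_abs pn)
    thus ?thesis using y Gam[of "sum k {1..M} + d"] by (simp add: F_def abs_mult)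
  qed
  have Gabs: "\<bar>G \<eta> n\<bar> \<le> G (\<lambda>i. \<bar>\<eta> i\<bar>) n" for \<eta> n
  proof -
    have fin: "finite (Kn n)" unfolding Kn_def K_def by (intro fps_prod_nth_PiE(1)) simp
    have "G \<eta> n = sum (F \<eta>) (Kn n)" for \<eta>
      using has_sum_unique[OF fiber has_sum_finite[OF fin]] .
    moreover have "norm (sum (F \<eta>) (Kn n)) \<le> sum (F (\<lambda>i. \<bar>\<eta> i\<bar>)) (Kn n)"
      by (rule sum_norm_le) (simp only: nrm order_refl)
    ultimately show ?thesis by (simp only: real_norm_def)
  qed
  have Ghs: "(G \<eta> has_sum borel_transform \<nu> (fps_X ^ d * W \<eta>) t) UNIV" for \<eta>
  proof (rule norm_summable_imp_has_sum[OF _ Gsums])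
    show "summable (\<lambda>n. norm (G \<eta> n))"
      by (rule summable_comparison_test'[where N = 0 and g = "G (\<lambda>i. \<bar>\<eta> i\<bar>)"])
         (use sums_summable[OF Gsums] Gabs in \<open>simp_all only: real_norm_def abs_idempotent\<close>)
  qed
  have "(\<lambda>x. F \<eta> (snd x)) summable_on Sigma UNIV Kn"
  proof (rule abs_summable_summable, rule summable_on_SigmaI)
    show "((\<lambda>k. norm (F \<eta> (snd (n, k)))) has_sum G (\<lambda>i. \<bar>\<eta> i\<bar>) n) (Kn n)" for n
      using fiber[of "\<lambda>i. \<bar>\<eta> i\<bar>" n] by (simp only: nrm snd_conv)
    show "G (\<lambda>i. \<bar>\<eta> i\<bar>) summable_on UNIV" using Ghs by (rule has_sum_imp_summable)
  qed (rule norm_ge_zero)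
  hence "((\<lambda>x. F \<eta> (snd x)) has_sum borel_transform \<nu> (fps_X ^ d * W \<eta>) t) (Sigma UNIV Kn)"
    by (rule has_sum_SigmaI[where g = "G \<eta>", rotated 2]) (unfold snd_conv, rule fiber, rule Ghs)
  moreover have "bij_betw snd (Sigma UNIV Kn) K"
    by (rule bij_betwI[where g = "\<lambda>k. (sum k {1..M}, k)"]) (auto simp: Kn_def)
  ultimately have "(F \<eta> has_sum borel_transform \<nu> (fps_X ^ d * W \<eta>) t) K"
    using has_sum_reindex_bij_betw[of snd "Sigma UNIV Kn" K "F \<eta>"] by simp
  hence "borel_transform \<nu> (fps_X ^ d * W \<eta>) t = infsum (F \<eta>) K" by (simp add: infsumI)
  also have "\<dots> = y ^ d * mittag_leffler \<nu> (\<nu> * real d + 1) M (\<lambda>i. real (g i)) (\<lambda>i. \<eta> i * y)"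
    unfolding mittag_leffler_def infsum_cmult_right'[symmetric] K_def
  proof (rule infsum_cong)
    fix k
    have "(\<Prod>j=1..M. fps_nth (w \<eta> j) (k j)) * y ^ sum k {1..M} =
       (\<Prod>j=1..M. pochhammer (real (g j)) (k j) / fact (k j) * \<eta> j ^ k j * y ^ k j)"
      unfolding power_sum prod.distrib[symmetric] by (intro prod.cong) (auto simp: wn)
    also have "\<dots> = (\<Prod>j=1..M. pochhammer (real (g j)) (k j)) * (\<Prod>j=1..M. (\<eta> j * y) ^ k j / fact (k j))"
      unfolding prod.distrib[symmetric] by (intro prod.cong) (auto simp: power_mult_distrib)
    finally show "F \<eta> k = y ^ d * ((\<Prod>j=1..M. pochhammer (real (g j)) (k j)) /
       Gamma (\<nu> * real (sum k {1..M}) + (\<nu> * real d + 1)) * (\<Prod>j=1..M. (\<eta> j * y) ^ k j / fact (k j)))"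
      unfolding F_def by (simp add: algebra_simps)
  qed
  finally show ?thesis unfolding yd y1 by (simp add: W_def w_def)
qed

section \<open>Uniqueness of Laplace transforms\<close>

text \<open>If \<open>k\<close> is orthogonal to all powers of \<open>w\<close>, it is orthogonal to every continuous function of \<open>w\<close>, since
  polynomials are uniformly dense on the interval \<open>[0, 1]\<close> where \<open>w\<close> takes its values on the support of \<open>k\<close>.\<close>

lemma weierstrass_orthogonal:
  fixes k :: "real \<Rightarrow> real"
  assumes k: "integrable lborel k"
    and w: "w \<in> borel_measurable lborel" "\<And>t. k t \<noteq> 0 \<Longrightarrow> w t \<in> {0..1}"
    and moments: "\<And>n. (\<integral>t. w t ^ n * k t \<partial>lborel) = 0"
    and g: "continuous_on UNIV (g :: real \<Rightarrow> real)"
  shows "(\<integral>t. g (w t) * k t \<partial>lborel) = 0"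
proof -
  have gm[measurable]: "g \<in> borel_measurable borel"
    using g by (rule borel_measurable_continuous_onI)
  note [measurable] = w(1) and km[measurable] = borel_measurable_integrable[OF k]
  have bd: "\<exists>B. \<forall>x\<in>{0..1}. \<bar>f x\<bar> \<le> B" if "continuous_on UNIV f" for f :: "real \<Rightarrow> real"
  proof -
    have "compact (f ` {0..1})"
      by (intro compact_continuous_image continuous_on_subset[OF that]) auto
    from compact_imp_bounded[OF this] show ?thesis by (auto simp: bounded_iff)
  qed
  have int: "integrable lborel (\<lambda>t. f (w t) * k t)" if f: "continuous_on UNIV f" for f :: "real \<Rightarrow> real"
  proof -
    have [measurable]: "f \<in> borel_measurable borel" using f by (rule borel_measurable_continuous_onI)
    obtain B where B: "\<forall>x\<in>{0..1}. \<bar>f x\<bar> \<le> B" using bd[OF f] by blast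
    show ?thesis
    proof (rule Bochner_Integration.integrable_bound)
      show "integrable lborel (\<lambda>t. B * k t)" using k by simp
      show "AE t in lborel. norm (f (w t) * k t) \<le> norm (B * k t)"
      proof (intro AE_I2)
        fix t show "norm (f (w t) * k t) \<le> norm (B * k t)"
        proof (cases "k t = 0")
          case False
          hence "\<bar>f (w t)\<bar> \<le> \<bar>B\<bar>" using B w(2)[OF False] by fastforce
          thus ?thesis by (simp add: abs_mult mult_right_mono)
        qed simp
      qed
    qed measurable
  qed
  have poly: "(\<integral>t. q (w t) * k t \<partial>lborel) = 0" if q: "real_polynomial_function q" for q
  proof -
    obtain a n where qa: "q = (\<lambda>x. \<Sum>i\<le>n. a i * x ^ i)" using q real_polynomial_function_iff_sum by blast
    have i: "integrable lborel (\<lambda>t. w t ^ i * k t)" for i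
      by (rule int[of "\<lambda>x. x ^ i"]) (auto intro: continuous_intros)
    have "(\<integral>t. q (w t) * k t \<partial>lborel) = (\<integral>t. (\<Sum>i\<le>n. a i * (w t ^ i * k t)) \<partial>lborel)"
      by (simp add: qa sum_distrib_right mult.assoc)
    also have "\<dots> = (\<Sum>i\<le>n. a i * (\<integral>t. w t ^ i * k t \<partial>lborel))"
      using i by (subst Bochner_Integration.integral_sum) auto
    finally show ?thesis by (simp add: moments)
  qed
  have "\<bar>\<integral>t. g (w t) * k t \<partial>lborel\<bar> \<le> e * (\<integral>t. \<bar>k t\<bar> \<partial>lborel)" if e: "e > 0" for e
  proof -
    obtain q where q: "real_polynomial_function q" "\<And>x. x \<in> {0..1} \<Longrightarrow> \<bar>g x - q x\<bar> < e"
      using Stone_Weierstrass_real_polynomial_function[of "{0..1::real}" g e] e continuous_on_subset[OF g]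
      by (metis compact_Icc subset_UNIV)
    have qc: "continuous_on UNIV q"
      using q(1) by (auto simp: real_polynomial_function_iff_sum intro!: continuous_intros)
    have "(\<integral>t. g (w t) * k t \<partial>lborel) = (\<integral>t. g (w t) * k t \<partial>lborel) - (\<integral>t. q (w t) * k t \<partial>lborel)"
      using poly[OF q(1)] by simp
    also have "\<dots> = (\<integral>t. g (w t) * k t - q (w t) * k t \<partial>lborel)"
      by (intro Bochner_Integration.integral_diff[symmetric] int g qc)
    also have "\<bar>\<dots>\<bar> \<le> (\<integral>t. e * \<bar>k t\<bar> \<partial>lborel)"
    proof (rule order_trans[OF integral_abs_bound], rule integral_mono)
      show "integrable lborel (\<lambda>t. \<bar>g (w t) * k t - q (w t) * k t\<bar>)"
        by (intro integrable_abs Bochner_Integration.integrable_diff int g qc)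
      show "integrable lborel (\<lambda>t. e * \<bar>k t\<bar>)" using k by simp
      fix t
      show "\<bar>g (w t) * k t - q (w t) * k t\<bar> \<le> e * \<bar>k t\<bar>"
      proof (cases "k t = 0")
        case False
        hence "\<bar>g (w t) - q (w t)\<bar> \<le> e" using q(2) w(2) by (simp add: less_imp_le)
        hence "\<bar>g (w t) - q (w t)\<bar> * \<bar>k t\<bar> \<le> e * \<bar>k t\<bar>" by (intro mult_right_mono) auto
        thus ?thesis by (simp add: abs_mult[symmetric] left_diff_distrib)
      qed simp
    qed
    finally show ?thesis by simp
  qed
  hence *: "\<And>e. e > 0 \<Longrightarrow> \<bar>\<integral>t. g (w t) * k t \<partial>lborel\<bar> \<le> e * (\<integral>t. \<bar>k t\<bar> \<partial>lborel)" .
  have "\<bar>\<integral>t. g (w t) * k t \<partial>lborel\<bar> \<le> 0 + e" if "e > 0" for e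
  proof -
    let ?K = "\<integral>t. \<bar>k t\<bar> \<partial>lborel"
    have K: "?K \<ge> 0" "?K + 1 > 0" by (simp_all add: add_nonneg_pos)
    have "\<bar>\<integral>t. g (w t) * k t \<partial>lborel\<bar> \<le> e / (?K + 1) * ?K"
      by (intro * divide_pos_pos that K(2))
    also have "\<dots> = (e * ?K) / (?K + 1)" by simp
    also have "\<dots> \<le> e" unfolding pos_divide_le_eq[OF K(2)] using that by (simp add: algebra_simps)
    finally show ?thesis by simp
  qed
  hence "\<bar>\<integral>t. g (w t) * k t \<partial>lborel\<bar> \<le> 0" by (rule field_le_epsilon)
  thus ?thesis by simp
qed

text \<open>With \<open>w = e\<^bsup>-t\<^esup>\<close> the hypothesis at \<open>l\<^sub>0, l\<^sub>0 + 1, \<dots>\<close> says that all moments vanish.  If \<open>h(a) \<noteq> 0\<close>, right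
  continuity keeps the sign of \<open>h\<close> on some \<open>(a, b)\<close>, and a bump function supported there gives a nonzero integral.
  Distribution functions are right continuous, which makes this the natural regularity to assume.\<close>

lemma laplace_transform_unique:
  fixes h :: "real \<Rightarrow> real"
  assumes cont: "\<And>t. t > 0 \<Longrightarrow> continuous (at_right t) h"
    and L: "\<And>l. l \<ge> l0 \<Longrightarrow> has_bochner_integral lborel (\<lambda>t. indicator {0<..} t * (exp (- l * t) * h t)) 0"
    and a: "a > 0"
  shows "h a = 0"
proof (rule ccontr)
  assume ha: "h a \<noteq> 0"
  define k where "k t = indicator {0<..} t * (exp (- l0 * t) * h t)" for t
  have k: "integrable lborel k" using L[of l0] by (simp add: k_def[abs_def] has_bochner_integral_iff)
  have mom: "(\<integral>t. exp (- t) ^ n * k t \<partial>lborel) = 0" for n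
  proof -
    have "exp (- t) ^ n * k t = indicator {0<..} t * (exp (- (l0 + n) * t) * h t)" for t
      unfolding k_def by (simp add: exp_of_nat_mult[symmetric] exp_add[symmetric] mult_ac ring_distribs)
    thus ?thesis using L[of "l0 + real n"] by (simp add: has_bochner_integral_iff)
  qed
  have "eventually (\<lambda>t. sgn (h a) * h t > 0) (at_right a)"
  proof -
    have "((\<lambda>t. sgn (h a) * h t) \<longlongrightarrow> sgn (h a) * h a) (at_right a)"
      using cont[OF a] by (intro tendsto_intros) (simp add: continuous_within)
    moreover have "sgn (h a) * h a > 0" using ha by (auto simp: sgn_if)
    ultimately show ?thesis by (rule order_tendstoD)
  qed
  then obtain b where b: "b > a" "\<And>t. a < t \<Longrightarrow> t < b \<Longrightarrow> sgn (h a) * h t > 0"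
    unfolding eventually_at_right_field by blast
  define g where "g x = max 0 ((exp (- a) - x) * (x - exp (- b)))" for x :: real
  have "continuous_on UNIV g" unfolding g_def by (intro continuous_intros)
  hence int0: "(\<integral>t. g (exp (- t)) * k t \<partial>lborel) = 0"
    by (intro weierstrass_orthogonal[where w = "\<lambda>t. exp (- t)" and k = k and g = g, OF k _ _ mom])
       (auto simp: k_def indicator_def split: if_splits)
  have gpos: "g (exp (- t)) > 0 \<longleftrightarrow> a < t \<and> t < b" for t
    using b(1) by (auto simp: g_def less_max_iff_disj zero_less_mult_iff)
  have g0: "g x \<ge> 0" for x by (simp add: g_def)
  define F where "F t = sgn (h a) * (g (exp (- t)) * k t)" for t
  have Fpos: "F t > 0" if "a < t" "t < b" for t
  proof -
    have "F t = g (exp (- t)) * exp (- l0 * t) * (sgn (h a) * h t)" using that a by (simp add: F_def k_def)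
    thus ?thesis using gpos[of t] that b(2)[of t] by simp
  qed
  have Fz: "F t = 0" if "\<not> (a < t \<and> t < b)" for t
    using gpos[of t] g0[of "exp (- t)"] that by (simp add: F_def)
  have Fnn: "F t \<ge> 0" for t using Fpos[of t] Fz[of t] by force
  have gb: "g (exp (- t)) \<le> 1" if "t > 0" for t
  proof -
    have "(exp (- a) - exp (-t)) * (exp (-t) - exp (- b)) \<le> 1" if t: "a < t" "t < b"
    proof (rule mult_le_one)
      have "exp (- a) \<le> 1" "exp (- t) \<le> 1" "exp (- b) \<le> exp (- t)" using t a by auto
      thus "exp (- a) - exp (- t) \<le> 1" "exp (- t) - exp (- b) \<le> 1" "0 \<le> exp (- t) - exp (- b)"
        using exp_gt_zero[of "- t"] exp_gt_zero[of "- b"] by linarith+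
    qed
    thus ?thesis using gpos[of t] g0[of "exp (-t)"] by (cases "a < t \<and> t < b") (auto simp: g_def)
  qed
  have "integrable lborel (\<lambda>t. g (exp (- t)) * k t)"
  proof (rule Bochner_Integration.integrable_bound[OF k])
    show "(\<lambda>t. g (exp (- t)) * k t) \<in> borel_measurable lborel"
      using borel_measurable_integrable[OF k] by (simp add: g_def)
    show "AE t in lborel. norm (g (exp (- t)) * k t) \<le> norm (k t)"
    proof (intro AE_I2)
      fix t show "norm (g (exp (- t)) * k t) \<le> norm (k t)"
        using gb[of t] g0[of "exp (-t)"] by (cases "t > 0") (auto simp: abs_mult k_def mult_left_le_one_le)
    qed
  qed
  hence Fint: "integrable lborel F" unfolding F_def by simp
  have "(\<integral>t. F t \<partial>lborel) = 0" using int0 by (simp add: F_def)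
  hence "AE t in lborel. F t = 0"
    using integral_nonneg_eq_0_iff_AE[OF Fint] Fnn by simp
  hence "AE t in lborel. t \<notin> {a<..<b}"
    by eventually_elim (use Fpos in force)
  hence "emeasure lborel {a<..<b} = 0"
    by (subst (asm) AE_iff_measurable[of "{a<..<b}"]) auto
  thus False using b(1) by simp
qed

section \<open>Subordinators, first passage and Erlang times\<close>

abbreviation erlang :: "nat \<Rightarrow> real \<Rightarrow> real measure" where
  "erlang k l \<equiv> density lborel (erlang_density k l)"

text \<open>The product of an Erlang density with an exponential is a multiple of another Erlang density with the same number
  of stages and a larger rate.\<close>

lemma laplace_erlang:
  assumes l: "l > 0" and c: "c \<ge> 0"
  shows "(\<integral>\<^sup>+s. ennreal (exp (- s * c)) \<partial>erlang k l) = ennreal ((l / (l + c)) ^ Suc k)"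
proof -
  have lc: "l + c > 0" using l c by simp
  have "(\<integral>\<^sup>+s. ennreal (exp (- s * c)) \<partial>erlang k l) =
     (\<integral>\<^sup>+s. ennreal (erlang_density k l s) * ennreal (exp (- s * c)) \<partial>lborel)"
    by (rule nn_integral_density) auto
  also have "\<dots> = (\<integral>\<^sup>+s. ennreal ((l / (l + c)) ^ Suc k) * ennreal (erlang_density k (l + c) s) \<partial>lborel)"
  proof (rule nn_integral_cong)
    fix s :: real
    have "erlang_density k l s * exp (- s * c) = (l / (l + c)) ^ Suc k * erlang_density k (l + c) s"
    proof -
      have "exp (- l * s) * exp (- s * c) = exp (- (l + c) * s)"
        by (simp add: exp_add[symmetric] algebra_simps)
      moreover have "(l + c) ^ Suc k \<noteq> 0" using lc by simp
      ultimately show ?thesis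
        by (simp add: erlang_density_def power_divide mult.assoc del: power_Suc)
    qed
    thus "ennreal (erlang_density k l s) * ennreal (exp (- s * c)) =
       ennreal ((l / (l + c)) ^ Suc k) * ennreal (erlang_density k (l + c) s)"
      using l c lc by (simp add: ennreal_mult[symmetric] del: power_Suc)
  qed
  also have "\<dots> = ennreal ((l / (l + c)) ^ Suc k) * (\<integral>\<^sup>+s. ennreal (erlang_density k (l + c) s) \<partial>lborel)"
    by (rule nn_integral_cmult) auto
  also have "(\<integral>\<^sup>+s. ennreal (erlang_density k (l + c) s) \<partial>lborel) = 1"
    using prob_space.emeasure_space_1[OF prob_space_erlang_density[OF lc, of k]] by (simp add: emeasure_density)
  finally show ?thesis by simp
qed

text \<open>Integration by parts in the form of Fubini's theorem for \<open>\<rho>\<close> and Lebesgue measure.\<close>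

lemma laplace_cdf:
  assumes \<rho>: "real_distribution \<rho>" and nn: "AE x in \<rho>. 0 \<le> x" and l: "l > 0"
    and L: "(\<integral>\<^sup>+x. ennreal (exp (- l * x)) \<partial>\<rho>) = ennreal r" and r: "r \<ge> 0"
  shows "has_bochner_integral lborel (\<lambda>t. indicator {0<..} t * (exp (- l * t) * cdf \<rho> t)) (r / l)"
proof -
  interpret real_distribution \<rho> by fact
  interpret pair_sigma_finite \<rho> lborel ..
  have sets_eq: "sets (\<rho> \<Otimes>\<^sub>M lborel) = sets (borel \<Otimes>\<^sub>M borel)"
    by (intro sets_pair_measure_cong) auto
  have [measurable]: "cdf \<rho> \<in> borel_measurable borel"
    by (intro borel_measurable_mono monoI cdf_nondecreasing)
  have [measurable]: "(\<lambda>(x, t). ennreal (indicator {0<..} t * exp (- l * t)) * indicator {x..} t) \<in> borel_measurable (\<rho> \<Otimes>\<^sub>M lborel)"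
  proof -
    have "(\<lambda>(x, t). ennreal (indicator {0<..} t * exp (- l * t)) * indicator {p. fst p \<le> snd p} (x, t)) \<in> borel_measurable (borel \<Otimes>\<^sub>M borel)"
      by measurable
    moreover have "(\<lambda>(x, t). ennreal (indicator {0<..} t * exp (- l * t)) * indicator {p. fst p \<le> snd p} (x, t)) = (\<lambda>(x, t). ennreal (indicator {0<..} t * exp (- l * t)) * indicator {x..} t)"
      by (auto simp: fun_eq_iff indicator_def)
    ultimately show ?thesis unfolding measurable_cong_sets[OF sets_eq refl] by (simp only:)
  qed
  have "(\<integral>\<^sup>+t. ennreal (indicator {0<..} t * (exp (- l * t) * cdf \<rho> t)) \<partial>lborel)
     = (\<integral>\<^sup>+t. (\<integral>\<^sup>+x. ennreal (indicator {0<..} t * exp (- l * t)) * indicator {x..} t \<partial>\<rho>) \<partial>lborel)"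
  proof (rule nn_integral_cong)
    fix t :: real
    have "ennreal (indicator {0<..} t * (exp (- l * t) * cdf \<rho> t)) = ennreal (indicator {0<..} t * exp (- l * t)) * emeasure \<rho> {..t}"
      unfolding emeasure_eq_measure cdf_def2 by (simp add: ennreal_mult[symmetric] mult.assoc)
    also have "\<dots> = (\<integral>\<^sup>+x. ennreal (indicator {0<..} t * exp (- l * t)) * indicator {..t} x \<partial>\<rho>)"
      by (rule nn_integral_cmult_indicator[symmetric]) simp
    also have "\<dots> = (\<integral>\<^sup>+x. ennreal (indicator {0<..} t * exp (- l * t)) * indicator {x..} t \<partial>\<rho>)"
      by (intro nn_integral_cong) (auto simp: indicator_def)
    finally show "ennreal (indicator {0<..} t * (exp (- l * t) * cdf \<rho> t)) = \<dots>" .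
  qed
  also have "\<dots> = (\<integral>\<^sup>+x. (\<integral>\<^sup>+t. ennreal (indicator {0<..} t * exp (- l * t)) * indicator {x..} t \<partial>lborel) \<partial>\<rho>)"
    by (rule Fubini') measurable
  also have "\<dots> = (\<integral>\<^sup>+x. ennreal (exp (- l * x)) * ennreal (1 / l) \<partial>\<rho>)"
  proof (rule nn_integral_cong_AE, use nn in eventually_elim)
    fix x :: real assume x: "0 \<le> x"
    have "(\<integral>\<^sup>+t. ennreal (indicator {0<..} t * exp (- l * t)) * indicator {x..} t \<partial>lborel) = (\<integral>\<^sup>+t. ennreal (exp (- l * t)) * indicator {x..} t \<partial>lborel)"
    proof (rule nn_integral_cong_AE, use AE_lborel_singleton[of "0 :: real"] in eventually_elim)
      fix t :: real assume "t \<noteq> 0"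
      thus "ennreal (indicator {0<..} t * exp (- l * t)) * indicator {x..} t = ennreal (exp (- l * t)) * indicator {x..} t"
        using x by (simp add: indicator_def)
    qed
    also have "\<dots> = ennreal (0 - (- exp (- l * x) / l))"
    proof (rule nn_integral_FTC_atLeast)
      show "((\<lambda>t. - exp (- l * t) / l) has_real_derivative exp (- l * t)) (at t)" for t
        using l by (auto intro!: derivative_eq_intros)
      have "filterlim (\<lambda>t. - l * t) at_bot at_top"
        using l by (intro filterlim_tendsto_neg_mult_at_bot[OF tendsto_const _ filterlim_ident]) simp
      hence "((\<lambda>t. exp (- l * t)) \<longlongrightarrow> 0) at_top" by (rule filterlim_compose[OF exp_at_bot])
      hence "((\<lambda>t. - exp (- l * t) / l) \<longlongrightarrow> - 0 / l) at_top"
        using l by (intro tendsto_divide tendsto_minus tendsto_const) auto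
      thus "((\<lambda>t. - exp (- l * t) / l) \<longlongrightarrow> 0) at_top" by simp
    qed auto
    finally show "(\<integral>\<^sup>+t. ennreal (indicator {0<..} t * exp (- l * t)) * indicator {x..} t \<partial>lborel) = ennreal (exp (- l * x)) * ennreal (1 / l)"
      using l by (simp add: ennreal_mult[symmetric])
  qed
  also have "\<dots> = ennreal r * ennreal (1 / l)"
    by (subst nn_integral_multc, simp, simp only: L)
  also have "\<dots> = ennreal (r / l)" using l r by (simp add: ennreal_mult[symmetric])
  finally show ?thesis
    using l r by (intro has_bochner_integral_nn_integral) (auto simp: cdf_nonneg)
qed

text \<open>The layer-cake formula for a random variable and an independent level \<open>s\<close> with law \<open>E\<close>, with closed and with open
  half-lines.\<close>

lemma Fubini_tail:
  fixes L :: "'w \<Rightarrow> real" and E :: "real measure"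
  assumes M: "prob_space M" and E: "prob_space E" "sets E = sets borel"
    and L: "L \<in> borel_measurable M"
  shows "(\<integral>\<^sup>+\<omega>. emeasure E {..L \<omega>} \<partial>M) = (\<integral>\<^sup>+s. emeasure M {\<omega>\<in>space M. s \<le> L \<omega>} \<partial>E)"
    and "(\<integral>\<^sup>+\<omega>. emeasure E {..<L \<omega>} \<partial>M) = (\<integral>\<^sup>+s. emeasure M {\<omega>\<in>space M. s < L \<omega>} \<partial>E)"
proof -
  interpret M: prob_space M by fact
  interpret E: prob_space E by fact
  interpret pair_sigma_finite E M ..
  note [measurable] = L
  note [measurable_cong] = E(2)
  have sp: "space E = UNIV" using sets_eq_imp_space_eq[OF E(2)] by simp
  let ?A = "{p \<in> space (E \<Otimes>\<^sub>M M). fst p \<le> L (snd p)}" and ?B = "{p \<in> space (E \<Otimes>\<^sub>M M). fst p < L (snd p)}"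
  have A: "?A \<in> sets (E \<Otimes>\<^sub>M M)" and B: "?B \<in> sets (E \<Otimes>\<^sub>M M)" by measurable
  have "(\<integral>\<^sup>+\<omega>. emeasure E {..L \<omega>} \<partial>M) = (\<integral>\<^sup>+\<omega>. emeasure E ((\<lambda>x. (x, \<omega>)) -` ?A) \<partial>M)"
    by (intro nn_integral_cong arg_cong2[where f = emeasure]) (auto simp: space_pair_measure sp)
  also have "\<dots> = emeasure (E \<Otimes>\<^sub>M M) ?A" by (rule emeasure_pair_measure_alt2[OF A, symmetric])
  also have "\<dots> = (\<integral>\<^sup>+s. emeasure M (Pair s -` ?A) \<partial>E)" by (rule M.emeasure_pair_measure_alt[OF A])
  also have "\<dots> = (\<integral>\<^sup>+s. emeasure M {\<omega>\<in>space M. s \<le> L \<omega>} \<partial>E)"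
    by (intro nn_integral_cong arg_cong2[where f = emeasure]) (auto simp: space_pair_measure sp)
  finally show "(\<integral>\<^sup>+\<omega>. emeasure E {..L \<omega>} \<partial>M) = \<dots>" .
  have "(\<integral>\<^sup>+\<omega>. emeasure E {..<L \<omega>} \<partial>M) = (\<integral>\<^sup>+\<omega>. emeasure E ((\<lambda>x. (x, \<omega>)) -` ?B) \<partial>M)"
    by (intro nn_integral_cong arg_cong2[where f = emeasure]) (auto simp: space_pair_measure sp)
  also have "\<dots> = emeasure (E \<Otimes>\<^sub>M M) ?B" by (rule emeasure_pair_measure_alt2[OF B, symmetric])
  also have "\<dots> = (\<integral>\<^sup>+s. emeasure M (Pair s -` ?B) \<partial>E)" by (rule M.emeasure_pair_measure_alt[OF B])
  also have "\<dots> = (\<integral>\<^sup>+s. emeasure M {\<omega>\<in>space M. s < L \<omega>} \<partial>E)"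
    by (intro nn_integral_cong arg_cong2[where f = emeasure]) (auto simp: space_pair_measure sp)
  finally show "(\<integral>\<^sup>+\<omega>. emeasure E {..<L \<omega>} \<partial>M) = \<dots>" .
qed

text \<open>The properties of \<open>\<Sum>\<^sub>j \<mu>\<^sub>j\<^bsup>1/\<nu>\<^sub>j\<^esup> H\<^sub>j\<close> used by the argument: monotone paths and one-dimensional laws given by a
  positive Laplace exponent \<open>f\<close>.  Positivity of \<open>f\<close> is what makes the paths unbounded, so that every level is passed.\<close>

locale laplace_subordinator = prob_space M for M :: "'w measure" +
  fixes S :: "real \<Rightarrow> 'w \<Rightarrow> real" and f :: "real \<Rightarrow> real"
  assumes meas: "0 \<le> s \<Longrightarrow> S s \<in> borel_measurable M"
    and mono: "AE \<omega> in M. mono_on {0..} (\<lambda>s. S s \<omega>)"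
    and nonneg: "AE \<omega> in M. 0 \<le> S 0 \<omega>"
    and laplace: "0 \<le> s \<Longrightarrow> 0 < l \<Longrightarrow> (\<integral>\<omega>. exp (- l * S s \<omega>) \<partial>M) = exp (- s * f l)"
    and f_pos: "0 < l \<Longrightarrow> 0 < f l"
begin

text \<open>The law of \<open>S s\<close>, extended to negative times so as to be a probability kernel on the whole line.\<close>

definition kernel :: "real \<Rightarrow> real measure" where
  "kernel s = distr M borel (S (max 0 s))"

text \<open>The law of \<open>S\<close> at an independent Erlang time with \<open>k + 1\<close> stages of rate \<open>\<Lambda>\<close>.\<close>

definition erlang_mixture :: "nat \<Rightarrow> real \<Rightarrow> real measure" where
  "erlang_mixture k \<Lambda> = erlang k \<Lambda> \<bind> kernel"

definition first_passage :: "real \<Rightarrow> 'w \<Rightarrow> real" where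
  "first_passage t \<omega> = Inf {s. s > 0 \<and> t \<le> S s \<omega>}"

lemma integrable_exp: "0 \<le> s \<Longrightarrow> 0 < l \<Longrightarrow> integrable M (\<lambda>\<omega>. exp (- l * S s \<omega>))"
  using laplace[of s l] not_integrable_integral_eq by fastforce

lemma emeasure_kernel:
  "X \<in> sets borel \<Longrightarrow> emeasure (kernel s) X = emeasure M {\<omega> \<in> space M. S (max 0 s) \<omega> \<in> X}"
  unfolding kernel_def using meas[of "max 0 s"]
  by (subst emeasure_distr) (auto intro!: arg_cong2[where f = emeasure])

text \<open>Monotone paths make \<open>s \<mapsto> P(S s \<le> t)\<close> decreasing in \<open>s\<close>, hence Borel.  Half-lines generate the Borel sets.\<close>

lemma measurable_kernel: "kernel \<in> borel \<rightarrow>\<^sub>M prob_algebra borel"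
proof (rule measurable_prob_algebra_generated[where \<Omega> = UNIV and G = "range atMost"])
  show "sets borel = sigma_sets UNIV (range (atMost :: real \<Rightarrow> real set))"
    by (subst borel_eq_atMost) simp
  show "Int_stable (range (atMost :: real \<Rightarrow> real set))"
    by (auto simp: Int_stable_def)
  show "prob_space (kernel s)" for s
    unfolding kernel_def by (intro prob_space_distr meas) simp
  fix A :: "real set" assume "A \<in> range atMost"
  then obtain t where A: "A = {..t}" by auto
  define h where "h s = - prob {\<omega> \<in> space M. S (max 0 s) \<omega> \<le> t}" for s
  have "h s \<le> h s'" if "s \<le> s'" for s s'
  proof -
    have [measurable]: "S (max 0 s) \<in> borel_measurable M" by (rule meas) simp
    have "prob {\<omega> \<in> space M. S (max 0 s') \<omega> \<le> t} \<le> prob {\<omega> \<in> space M. S (max 0 s) \<omega> \<le> t}"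
    proof (rule finite_measure_mono_AE)
      show "AE \<omega> in M. \<omega> \<in> {\<omega> \<in> space M. S (max 0 s') \<omega> \<le> t} \<longrightarrow> \<omega> \<in> {\<omega> \<in> space M. S (max 0 s) \<omega> \<le> t}"
        using mono
      proof eventually_elim
        case (elim \<omega>)
        have "S (max 0 s) \<omega> \<le> S (max 0 s') \<omega>" using that by (intro mono_onD[OF elim]) auto
        thus ?case by auto
      qed
    qed measurable
    thus ?thesis by (simp add: h_def)
  qed
  hence "h \<in> borel_measurable borel" by (intro borel_measurable_mono monoI)
  hence "(\<lambda>s. ennreal (- h s)) \<in> borel_measurable borel" by simp
  thus "(\<lambda>s. emeasure (kernel s) A) \<in> borel_measurable borel"
    by (simp add: emeasure_kernel A h_def emeasure_eq_measure)
qed (auto simp: kernel_def)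

lemma measurable_kernel_erlang: "kernel \<in> erlang k \<Lambda> \<rightarrow>\<^sub>M subprob_algebra borel"
  using measurable_prob_algebraD[OF measurable_kernel] by (simp add: measurable_def)

lemma emeasure_erlang_mixture:
  "X \<in> sets borel \<Longrightarrow> emeasure (erlang_mixture k \<Lambda>) X =
     (\<integral>\<^sup>+s. emeasure M {\<omega> \<in> space M. S (max 0 s) \<omega> \<in> X} \<partial>erlang k \<Lambda>)"
  unfolding erlang_mixture_def
  by (subst emeasure_bind[OF _ measurable_kernel_erlang]) (simp_all add: emeasure_kernel)

lemma real_distribution_erlang_mixture:
  assumes "\<Lambda> > 0"
  shows "real_distribution (erlang_mixture k \<Lambda>)"
proof -
  have E: "prob_space (erlang k \<Lambda>)" using assms by (rule prob_space_erlang_density)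
  have "prob_space (kernel s)" for s
    unfolding kernel_def by (intro prob_space_distr meas) simp
  hence "prob_space (erlang_mixture k \<Lambda>)"
    unfolding erlang_mixture_def
    by (intro prob_space.prob_space_bind[OF E _ measurable_kernel_erlang]) auto
  moreover have "sets (erlang_mixture k \<Lambda>) = sets borel"
    unfolding erlang_mixture_def
    by (rule sets_bind) (auto simp: kernel_def)
  ultimately show ?thesis
    by (simp add: real_distribution_def real_distribution_axioms_def)
qed

lemma AE_nonneg: "AE \<omega> in M. \<forall>s\<ge>0. 0 \<le> S s \<omega>"
  using mono nonneg
proof eventually_elim
  case (elim \<omega>)
  thus ?case using mono_onD[OF elim(1), of 0] by (auto intro: order_trans)
qed

lemma erlang_mixture_nonneg:
  assumes "\<Lambda> > 0"
  shows "AE x in erlang_mixture k \<Lambda>. 0 \<le> x"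
proof -
  interpret X: real_distribution "erlang_mixture k \<Lambda>" by (rule real_distribution_erlang_mixture[OF assms])
  have "emeasure M {\<omega> \<in> space M. S (max 0 s) \<omega> \<in> {..<0}} = 0" for s
  proof -
    have [measurable]: "S (max 0 s) \<in> borel_measurable M" by (rule meas) simp
    have "AE \<omega> in M. \<not> S (max 0 s) \<omega> < 0"
      using AE_nonneg by eventually_elim (simp add: not_less)
    thus ?thesis by (subst (asm) AE_iff_measurable[OF _ refl]) auto
  qed
  hence "emeasure (erlang_mixture k \<Lambda>) {..<0} = 0" by (simp add: emeasure_erlang_mixture)
  hence "{..<0} \<in> null_sets (erlang_mixture k \<Lambda>)" by (simp add: null_sets_def)
  from AE_not_in[OF this] show ?thesis by eventually_elim (simp add: not_less)
qed

lemma laplace_erlang_mixture: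
  assumes \<Lambda>: "\<Lambda> > 0" and l: "l > 0"
  shows "(\<integral>\<^sup>+x. ennreal (exp (- l * x)) \<partial>erlang_mixture k \<Lambda>) = ennreal ((\<Lambda> / (\<Lambda> + f l)) ^ Suc k)"
proof -
  have "(\<integral>\<^sup>+x. ennreal (exp (- l * x)) \<partial>erlang_mixture k \<Lambda>) = (\<integral>\<^sup>+s. \<integral>\<^sup>+x. ennreal (exp (- l * x)) \<partial>kernel s \<partial>erlang k \<Lambda>)"
    unfolding erlang_mixture_def by (rule nn_integral_bind[OF _ measurable_kernel_erlang]) simp
  also have "\<dots> = (\<integral>\<^sup>+s. ennreal (exp (- s * f l)) \<partial>erlang k \<Lambda>)"
  proof (rule nn_integral_cong_AE)
    have "AE s in erlang k \<Lambda>. 0 \<le> s"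
      by (subst AE_density) (auto simp: erlang_density_def not_less)
    thus "AE s in erlang k \<Lambda>. (\<integral>\<^sup>+x. ennreal (exp (- l * x)) \<partial>kernel s) = ennreal (exp (- s * f l))"
    proof eventually_elim
      case (elim s)
      have "(\<integral>\<^sup>+x. ennreal (exp (- l * x)) \<partial>kernel s) = (\<integral>\<^sup>+\<omega>. ennreal (exp (- l * S s \<omega>)) \<partial>M)"
        unfolding kernel_def using elim meas[of s] by (subst nn_integral_distr) (auto simp: max_def)
      also have "\<dots> = ennreal (\<integral>\<omega>. exp (- l * S s \<omega>) \<partial>M)"
        using elim l by (intro nn_integral_eq_integral integrable_exp) auto
      finally show ?case using laplace[OF elim l] by simp
    qed
  qed
  also have "\<dots> = ennreal ((\<Lambda> / (\<Lambda> + f l)) ^ Suc k)"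
    using \<Lambda> f_pos[OF l] by (intro laplace_erlang) auto
  finally show ?thesis .
qed

text \<open>Markov's inequality gives \<open>P(S n < t) \<le> e\<^sup>t e\<^bsup>-n f(1)\<^esup>\<close>, which tends to \<open>0\<close>.\<close>

lemma AE_unbounded: "AE \<omega> in M. \<exists>n::nat. t \<le> S (real n) \<omega>"
proof -
  define A where "A n = {\<omega> \<in> space M. S (real n) \<omega> < t}" for n :: nat
  have [measurable]: "S (real n) \<in> borel_measurable M" for n by (rule meas) simp
  have A: "A n \<in> events" for n unfolding A_def by measurable
  have bound: "prob (A n) \<le> exp t * exp (- f 1) ^ n" for n
  proof -
    have "prob (A n) = (\<integral>\<omega>. indicator (A n) \<omega> \<partial>M)"
      using A by (simp add: Bochner_Integration.integral_indicator sets.Int_space_eq2)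
    also have "\<dots> \<le> (\<integral>\<omega>. exp t * exp (- 1 * S (real n) \<omega>) \<partial>M)"
    proof (rule integral_mono)
      show "integrable M (indicator (A n) :: 'w \<Rightarrow> real)"
        by (intro integrable_real_indicator A) (simp add: emeasure_eq_measure)
      show "integrable M (\<lambda>\<omega>. exp t * exp (- 1 * S (real n) \<omega>))"
        by (intro integrable_mult_right integrable_exp) auto
      show "indicator (A n) \<omega> \<le> exp t * exp (- 1 * S (real n) \<omega>)" for \<omega>
        by (auto simp: indicator_def A_def exp_add[symmetric])
    qed
    also have "\<dots> = exp t * exp (- real n * f 1)" using laplace[of "real n" 1] by simp
    also have "exp (- real n * f 1) = exp (- f 1) ^ n" by (simp add: exp_of_nat_mult[symmetric])
    finally show ?thesis .
  qed
  have lim: "(\<lambda>n. exp t * exp (- f 1) ^ n) \<longlonglongrightarrow> exp t * 0"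
    using f_pos[of 1] by (intro tendsto_mult[OF tendsto_const LIMSEQ_power_zero]) simp
  have "prob (\<Inter>n. A n) \<le> exp t * exp (- f 1) ^ n" for n
    by (rule order_trans[OF finite_measure_mono[OF _ A[of n]] bound]) blast
  hence "prob (\<Inter>n. A n) \<le> exp t * 0" by (intro LIMSEQ_le_const[OF lim]) blast
  hence "prob (\<Inter>n. A n) = 0" using measure_nonneg[of M "\<Inter>n. A n"] by linarith
  hence "(\<Inter>n. A n) \<in> null_sets M"
    using A by (simp add: null_sets_def emeasure_eq_measure sets.countable_INT)
  from AE_not_in[OF this] AE_space show ?thesis
  proof eventually_elim
    case (elim \<omega>)
    thus ?case by (auto simp: A_def not_less)
  qed
qed

text \<open>Paths are merely monotone here, so the equivalence of \<open>first_passage t \<le> s\<close> and \<open>t \<le> S s\<close> may fail at one value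
  of \<open>s\<close>; the two implications that always hold suffice below.\<close>

lemma AE_first_passage:
  assumes t: "t > 0"
  shows "AE \<omega> in M. 0 \<le> first_passage t \<omega> \<and>
    (\<forall>s>0. (first_passage t \<omega> < s \<longrightarrow> t \<le> S s \<omega>) \<and> (t \<le> S s \<omega> \<longrightarrow> first_passage t \<omega> \<le> s))"
  using AE_unbounded[of t] mono
proof eventually_elim
  case (elim \<omega>)
  let ?Z = "{s. s > 0 \<and> t \<le> S s \<omega>}"
  have bdd: "bdd_below ?Z" by (rule bdd_belowI[of _ 0]) auto
  obtain n :: nat where n: "t \<le> S (real n) \<omega>" using elim(1) by blast
  have "S (real n) \<omega> \<le> S (real (Suc n)) \<omega>" by (intro mono_onD[OF elim(2)]) auto
  hence ne: "?Z \<noteq> {}" using n by (intro ex_in_conv[THEN iffD1] exI[of _ "real (Suc n)"]) auto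
  have "0 \<le> first_passage t \<omega>" unfolding first_passage_def by (rule cInf_greatest[OF ne]) auto
  moreover have "t \<le> S s \<omega>" if less: "first_passage t \<omega> < s" for s
  proof -
    obtain z where "z \<in> ?Z" "z < s" using cInf_less_iff[OF ne bdd, of s] less unfolding first_passage_def by auto
    thus ?thesis using mono_onD[OF elim(2), of z s] by auto
  qed
  moreover have "first_passage t \<omega> \<le> s" if "s > 0" "t \<le> S s \<omega>" for s
    unfolding first_passage_def using that by (intro cInf_lower bdd) auto
  ultimately show ?case by blast
qed

text \<open>The two implications for \<open>first_passage\<close> sandwich \<open>P(S s < t)\<close> between \<open>P(s < first_passage t)\<close> and
  \<open>P(s \<le> first_passage t)\<close>.  Their integrals against the Erlang law agree because that law has no atoms.\<close>

lemma nn_integral_erlang_first_passage: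
  assumes t: "t > 0" and \<Lambda>: "\<Lambda> > 0" and L[measurable]: "first_passage t \<in> borel_measurable M"
  shows "(\<integral>\<^sup>+\<omega>. emeasure (erlang k \<Lambda>) {..first_passage t \<omega>} \<partial>M) = emeasure (erlang_mixture k \<Lambda>) {..<t}"
proof (rule antisym)
  let ?E = "erlang k \<Lambda>" and ?L = "first_passage t"
  have E: "prob_space ?E" using \<Lambda> by (rule prob_space_erlang_density)
  have Em: "sets ?E = sets borel" by simp
  note Fub = Fubini_tail[OF prob_space_axioms E Em L]
  have mS: "S (max 0 s) \<in> borel_measurable M" for s by (rule meas) simp
  have pos: "AE s in ?E. 0 < s"
    using AE_lborel_singleton[of "0 :: real"]
    by (subst AE_density) (auto simp: erlang_density_def not_less)
  have "emeasure ?E {x} = 0" for x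
  proof -
    have "AE s in ?E. s \<noteq> x" using AE_lborel_singleton[of x] by (subst AE_density) auto
    thus ?thesis by (subst (asm) AE_iff_measurable[of "{x}"]) auto
  qed
  hence "{x} \<in> null_sets ?E" for x by (simp add: null_sets_def)
  hence "emeasure ?E ({..<x} \<union> {x}) = emeasure ?E {..<x}" for x
    by (intro emeasure_Un_null_set) auto
  moreover have "{..<x} \<union> {x} = {..x}" for x :: real by auto
  ultimately have "(\<integral>\<^sup>+\<omega>. emeasure ?E {..?L \<omega>} \<partial>M) = (\<integral>\<^sup>+\<omega>. emeasure ?E {..<?L \<omega>} \<partial>M)" by simp
  also have "\<dots> = (\<integral>\<^sup>+s. emeasure M {\<omega>\<in>space M. s < ?L \<omega>} \<partial>?E)" by (rule Fub(2))
  also have "\<dots> \<le> (\<integral>\<^sup>+s. emeasure M {\<omega>\<in>space M. S (max 0 s) \<omega> \<in> {..<t}} \<partial>?E)"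
  proof (rule nn_integral_mono_AE, use pos in eventually_elim)
    fix s :: real assume s: "0 < s"
    show "emeasure M {\<omega>\<in>space M. s < ?L \<omega>} \<le> emeasure M {\<omega>\<in>space M. S (max 0 s) \<omega> \<in> {..<t}}"
    proof (rule emeasure_mono_AE)
      show "AE \<omega> in M. \<omega> \<in> {\<omega>\<in>space M. s < ?L \<omega>} \<longrightarrow> \<omega> \<in> {\<omega>\<in>space M. S (max 0 s) \<omega> \<in> {..<t}}"
        using AE_first_passage[OF t] by eventually_elim (use s in \<open>force simp: max_def\<close>)
    qed (use mS[of s] in measurable)
  qed
  also have "\<dots> = emeasure (erlang_mixture k \<Lambda>) {..<t}" by (rule emeasure_erlang_mixture[symmetric]) simp
  finally show "(\<integral>\<^sup>+\<omega>. emeasure ?E {..?L \<omega>} \<partial>M) \<le> emeasure (erlang_mixture k \<Lambda>) {..<t}" .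
  have "emeasure (erlang_mixture k \<Lambda>) {..<t} = (\<integral>\<^sup>+s. emeasure M {\<omega>\<in>space M. S (max 0 s) \<omega> \<in> {..<t}} \<partial>?E)"
    by (rule emeasure_erlang_mixture) simp
  also have "\<dots> \<le> (\<integral>\<^sup>+s. emeasure M {\<omega>\<in>space M. s \<le> ?L \<omega>} \<partial>?E)"
  proof (rule nn_integral_mono_AE, use pos in eventually_elim)
    fix s :: real assume s: "0 < s"
    show "emeasure M {\<omega>\<in>space M. S (max 0 s) \<omega> \<in> {..<t}} \<le> emeasure M {\<omega>\<in>space M. s \<le> ?L \<omega>}"
    proof (rule emeasure_mono_AE)
      show "AE \<omega> in M. \<omega> \<in> {\<omega>\<in>space M. S (max 0 s) \<omega> \<in> {..<t}} \<longrightarrow> \<omega> \<in> {\<omega>\<in>space M. s \<le> ?L \<omega>}"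
        using AE_first_passage[OF t] by eventually_elim (use s in \<open>force simp: max_def\<close>)
    qed measurable
  qed
  also have "\<dots> = (\<integral>\<^sup>+\<omega>. emeasure ?E {..?L \<omega>} \<partial>M)" by (rule Fub(1)[symmetric])
  finally show "emeasure (erlang_mixture k \<Lambda>) {..<t} \<le> (\<integral>\<^sup>+\<omega>. emeasure ?E {..?L \<omega>} \<partial>M)" .
qed

lemma integral_erlang_CDF_first_passage:
  assumes t: "t > 0" and \<Lambda>: "\<Lambda> > 0" and L[measurable]: "first_passage t \<in> borel_measurable M"
  shows "has_bochner_integral M (\<lambda>\<omega>. erlang_CDF k \<Lambda> (first_passage t \<omega>)) (measure (erlang_mixture k \<Lambda>) {..<t})"
proof (rule has_bochner_integral_nn_integral)
  interpret X: real_distribution "erlang_mixture k \<Lambda>" by (rule real_distribution_erlang_mixture[OF \<Lambda>])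
  show "(\<lambda>\<omega>. erlang_CDF k \<Lambda> (first_passage t \<omega>)) \<in> borel_measurable M"
    unfolding erlang_CDF_def by measurable
  show "(\<integral>\<^sup>+\<omega>. ennreal (erlang_CDF k \<Lambda> (first_passage t \<omega>)) \<partial>M) = ennreal (measure (erlang_mixture k \<Lambda>) {..<t})"
    using nn_integral_erlang_first_passage[OF t \<Lambda> L, of k] \<Lambda>
    by (simp add: emeasure_erlang_density X.emeasure_eq_measure)
qed (use \<Lambda> in auto)

end

section \<open>A process observed at an independent random time\<close>

text \<open>Independence holds only time by time, so the random time is approximated from the right by times \<open>d n (L \<omega>)\<close> with
  countably many values, for which the claim is a sum over these values.  Right continuity of the integer-valued
  paths makes the observed value eventually constant along the approximation.  Completeness of the measure is used
  for the measurability of the event on the left, since right continuity holds only almost everywhere.\<close>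

lemma (in complete_measure) prob_random_time:
  assumes M: "prob_space M"
    and A: "\<And>s. 0 \<le> s \<Longrightarrow> (\<lambda>\<omega>. real (A s \<omega>)) \<in> borel_measurable M"
    and rc: "AE \<omega> in M. \<forall>s\<ge>0. continuous (at_right s) (\<lambda>s. real (A s \<omega>))"
    and L: "L \<in> borel_measurable M" "AE \<omega> in M. 0 \<le> L \<omega>"
    and ind: "\<And>s. 0 \<le> s \<Longrightarrow> prob_space.indep_var M borel (\<lambda>\<omega>. real (A s \<omega>)) borel L"
    and law: "\<And>s. 0 \<le> s \<Longrightarrow> measure M {\<omega> \<in> space M. A s \<omega> = k} = \<pi> s"
    and \<pi>: "continuous_on UNIV \<pi>" "\<And>s. 0 \<le> s \<Longrightarrow> 0 \<le> \<pi> s" "\<And>s. 0 \<le> s \<Longrightarrow> \<pi> s \<le> 1"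
  shows "measure M {\<omega> \<in> space M. A (L \<omega>) \<omega> = k} = (\<integral>\<omega>. \<pi> (L \<omega>) \<partial>M)"
proof -
  interpret prob_space M by fact
  note [measurable] = L(1)
  have [measurable]: "\<pi> \<in> borel_measurable borel" using \<pi>(1) by (rule borel_measurable_continuous_onI)
  have Ak[measurable]: "{\<omega> \<in> space M. A s \<omega> = k} \<in> sets M" if "0 \<le> s" for s
  proof -
    have [measurable]: "(\<lambda>\<omega>. real (A s \<omega>)) \<in> borel_measurable M" by (rule A[OF that])
    have "{\<omega> \<in> space M. real (A s \<omega>) = real k} \<in> sets M" by measurable
    thus ?thesis by simp
  qed
  define a where "a n i = (real i + 1) / (real n + 1)" for n i :: nat
  have a0: "0 \<le> a n i" for n i by (simp add: a_def)
  \<comment> \<open>the next point of the grid \<open>{1, 2, \<dots>} / (n + 1)\<close> strictly to the right of \<open>x\<close>\<close>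
  define d where "d n x = a n (nat \<lfloor>(real n + 1) * x\<rfloor>)" for n and x :: real
  define I where "I n i = {\<omega> \<in> space M. nat \<lfloor>(real n + 1) * L \<omega>\<rfloor> = i}" for n i :: nat
  have I[measurable]: "I n i \<in> sets M" for n i unfolding I_def by measurable
  have disj: "disjoint_family (I n)" for n by (auto simp: disjoint_family_on_def I_def)
  have d_bounds: "x < d n x" "d n x \<le> x + 1 / (real n + 1)" if "0 \<le> x" for n and x :: real
  proof -
    have 0: "real (nat \<lfloor>(real n + 1) * x\<rfloor>) = of_int \<lfloor>(real n + 1) * x\<rfloor>" using that by simp
    have n: "real n + 1 > 0" by simp
    let ?z = "of_int \<lfloor>(real n + 1) * x\<rfloor> :: real"
    have "x * (real n + 1) < ?z + 1" "?z \<le> x * (real n + 1)" unfolding mult.commute[of x] by linarith+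
    hence "x < (?z + 1) / (real n + 1)" "?z / (real n + 1) \<le> x"
      unfolding pos_less_divide_eq[OF n] pos_divide_le_eq[OF n] by blast+
    thus "x < d n x" "d n x \<le> x + 1 / (real n + 1)"
      unfolding d_def a_def 0 add_divide_distrib by simp_all
  qed
  have d_lim: "(\<lambda>n. d n x) \<longlonglongrightarrow> x" if "0 \<le> x" for x
  proof (rule tendsto_sandwich[where f = "\<lambda>_. x" and h = "\<lambda>n. x + 1 / (real n + 1)"])
    show "(\<lambda>n. x + 1 / (real n + 1)) \<longlonglongrightarrow> x"
      using tendsto_add[OF tendsto_const[of x] LIMSEQ_inverse_real_of_nat] by (simp add: inverse_eq_divide add.commute)
    show "\<forall>\<^sub>F n in sequentially. x \<le> d n x" using d_bounds[OF that] by (intro always_eventually) (auto intro: less_imp_le)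
    show "\<forall>\<^sub>F n in sequentially. d n x \<le> x + 1 / (real n + 1)" using d_bounds[OF that] by (intro always_eventually) auto
  qed auto
  \<comment> \<open>written as countable sums over the disjoint events \<open>I n i\<close> so that measurability is evident\<close>
  define X where "X n \<omega> = enn2real (\<Sum>i. indicator {\<omega> \<in> space M. A (a n i) \<omega> = k} \<omega> * indicator (I n i) \<omega>)" for n \<omega>
  define Y where "Y n \<omega> = enn2real (\<Sum>i. ennreal (\<pi> (a n i)) * indicator (I n i) \<omega>)" for n \<omega>
  have Xv: "X n \<omega> = indicator {\<omega> \<in> space M. A (d n (L \<omega>)) \<omega> = k} \<omega>" and Yv: "Y n \<omega> = \<pi> (d n (L \<omega>))"
    if "\<omega> \<in> space M" for n \<omega>
  proof -
    let ?i = "nat \<lfloor>(real n + 1) * L \<omega>\<rfloor>"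
    have i: "\<omega> \<in> I n ?i" using that by (simp add: I_def)
    show "X n \<omega> = indicator {\<omega> \<in> space M. A (d n (L \<omega>)) \<omega> = k} \<omega>"
      unfolding X_def suminf_cmult_indicator[OF disj i] by (simp add: d_def indicator_def)
    show "Y n \<omega> = \<pi> (d n (L \<omega>))"
      unfolding Y_def suminf_cmult_indicator[OF disj i] by (simp add: d_def \<pi>(2)[OF a0])
  qed
  have Xm[measurable]: "X n \<in> borel_measurable M" for n
    unfolding X_def[abs_def] by (intro borel_measurable_enn2real borel_measurable_suminf_order borel_measurable_times_ennreal borel_measurable_indicator Ak a0 I)
  have Ym[measurable]: "Y n \<in> borel_measurable M" for n
    unfolding Y_def[abs_def] by (intro borel_measurable_enn2real borel_measurable_suminf_order borel_measurable_times_ennreal borel_measurable_indicator I borel_measurable_const)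
  have XY: "(\<integral>\<omega>. X n \<omega> \<partial>M) = (\<integral>\<omega>. Y n \<omega> \<partial>M)" for n
  proof -
    let ?B = "\<lambda>i. {\<omega> \<in> space M. A (a n i) \<omega> = k}"
    have "(\<integral>\<^sup>+\<omega>. ennreal (X n \<omega>) \<partial>M) = (\<integral>\<^sup>+\<omega>. (\<Sum>i. indicator (?B i \<inter> I n i) \<omega>) \<partial>M)"
    proof (rule nn_integral_cong)
      fix \<omega> assume \<omega>: "\<omega> \<in> space M"
      let ?i = "nat \<lfloor>(real n + 1) * L \<omega>\<rfloor>"
      have i: "\<omega> \<in> I n ?i" using \<omega> by (simp add: I_def)
      have "(\<Sum>i. indicator (?B i \<inter> I n i) \<omega> :: ennreal) = (\<Sum>i. indicator (?B i) \<omega> * indicator (I n i) \<omega>)"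
        by (simp add: indicator_inter_arith)
      also have "\<dots> = indicator (?B ?i) \<omega>" by (rule suminf_cmult_indicator[OF disj i])
      finally show "ennreal (X n \<omega>) = (\<Sum>i. indicator (?B i \<inter> I n i) \<omega>)"
        unfolding Xv[OF \<omega>] by (simp add: d_def indicator_def)
    qed
    also have "\<dots> = (\<Sum>i. \<integral>\<^sup>+\<omega>. indicator (?B i \<inter> I n i) \<omega> \<partial>M)"
      by (intro nn_integral_suminf borel_measurable_indicator sets.Int Ak a0 I)
    also have "\<dots> = (\<Sum>i. ennreal (\<pi> (a n i)) * emeasure M (I n i))"
    proof (rule suminf_cong)
      fix i
      have "prob (?B i \<inter> I n i) = prob ((\<lambda>\<omega>. (real (A (a n i) \<omega>), L \<omega>)) -` ({real k} \<times> {x. nat \<lfloor>(real n + 1) * x\<rfloor> = i}) \<inter> space M)"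
        by (intro arg_cong[where f = prob]) (auto simp: I_def)
      also have "\<dots> = prob ((\<lambda>\<omega>. real (A (a n i) \<omega>)) -` {real k} \<inter> space M) * prob (L -` {x. nat \<lfloor>(real n + 1) * x\<rfloor> = i} \<inter> space M)"
        by (rule indep_varD[OF ind[OF a0]]) measurable
      also have "(\<lambda>\<omega>. real (A (a n i) \<omega>)) -` {real k} \<inter> space M = ?B i" by auto
      also have "L -` {x. nat \<lfloor>(real n + 1) * x\<rfloor> = i} \<inter> space M = I n i" by (auto simp: I_def)
      finally have "prob (?B i \<inter> I n i) = \<pi> (a n i) * prob (I n i)" using law[OF a0] by simp
      moreover have "?B i \<inter> I n i \<in> sets M" by (intro sets.Int Ak a0 I)
      ultimately show "(\<integral>\<^sup>+\<omega>. indicator (?B i \<inter> I n i) \<omega> \<partial>M) = ennreal (\<pi> (a n i)) * emeasure M (I n i)"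
        using \<pi>(2)[OF a0] by (simp add: emeasure_eq_measure ennreal_mult)
    qed
    also have "\<dots> = (\<Sum>i. \<integral>\<^sup>+\<omega>. ennreal (\<pi> (a n i)) * indicator (I n i) \<omega> \<partial>M)"
      by (intro suminf_cong nn_integral_cmult_indicator[symmetric] I)
    also have "\<dots> = (\<integral>\<^sup>+\<omega>. (\<Sum>i. ennreal (\<pi> (a n i)) * indicator (I n i) \<omega>) \<partial>M)"
      by (intro nn_integral_suminf[symmetric] borel_measurable_times_ennreal borel_measurable_const borel_measurable_indicator I)
    also have "\<dots> = (\<integral>\<^sup>+\<omega>. ennreal (Y n \<omega>) \<partial>M)"
    proof (rule nn_integral_cong)
      fix \<omega> assume \<omega>: "\<omega> \<in> space M"
      let ?i = "nat \<lfloor>(real n + 1) * L \<omega>\<rfloor>"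
      have i: "\<omega> \<in> I n ?i" using \<omega> by (simp add: I_def)
      show "(\<Sum>i. ennreal (\<pi> (a n i)) * indicator (I n i) \<omega>) = ennreal (Y n \<omega>)"
        unfolding Yv[OF \<omega>] suminf_cmult_indicator[OF disj i] by (simp add: d_def)
    qed
    finally have nn: "(\<integral>\<^sup>+\<omega>. ennreal (X n \<omega>) \<partial>M) = (\<integral>\<^sup>+\<omega>. ennreal (Y n \<omega>) \<partial>M)" .
    have "(\<integral>\<omega>. X n \<omega> \<partial>M) = enn2real (\<integral>\<^sup>+\<omega>. ennreal (X n \<omega>) \<partial>M)"
      by (intro integral_eq_nn_integral Xm AE_I2) (simp add: Xv)
    moreover have "(\<integral>\<omega>. Y n \<omega> \<partial>M) = enn2real (\<integral>\<^sup>+\<omega>. ennreal (Y n \<omega>) \<partial>M)"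
      by (intro integral_eq_nn_integral Ym AE_I2) (simp add: Yv \<pi>(2) d_def a0)
    ultimately show ?thesis using nn by simp
  qed
  let ?K = "{\<omega> \<in> space M. A (L \<omega>) \<omega> = k}"
  have Xlim: "AE \<omega> in M. (\<lambda>n. X n \<omega>) \<longlonglongrightarrow> indicator ?K \<omega>"
    using rc L(2) AE_space
  proof eventually_elim
    case (elim \<omega>)
    have "filterlim (\<lambda>n. d n (L \<omega>)) (at_right (L \<omega>)) sequentially"
      using d_lim[OF elim(2)] d_bounds(1)[OF elim(2)]
      by (intro filterlim_at_withinI) auto
    moreover have "((\<lambda>s. real (A s \<omega>)) \<longlongrightarrow> real (A (L \<omega>) \<omega>)) (at_right (L \<omega>))"
      using elim(1,2) by (simp add: continuous_within)
    ultimately have "(\<lambda>n. real (A (d n (L \<omega>)) \<omega>)) \<longlonglongrightarrow> real (A (L \<omega>) \<omega>)"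
      by (rule filterlim_compose[rotated])
    hence "\<forall>\<^sub>F n in sequentially. dist (real (A (d n (L \<omega>)) \<omega>)) (real (A (L \<omega>) \<omega>)) < 1"
      by (rule tendstoD) simp
    hence "\<forall>\<^sub>F n in sequentially. X n \<omega> = indicator ?K \<omega>"
    proof eventually_elim
      case (elim n)
      hence "A (d n (L \<omega>)) \<omega> = A (L \<omega>) \<omega>" by (simp add: dist_real_def)
      thus ?case using \<open>\<omega> \<in> space M\<close> by (simp add: Xv indicator_def)
    qed
    thus ?case by (rule tendsto_eventually)
  qed
  have K: "?K \<in> sets M"
  proof (rule in_sets_AE)
    show "{\<omega> \<in> space M. lim (\<lambda>n. X n \<omega>) = 1} \<in> sets M" by measurable
    show "AE \<omega> in M. \<omega> \<in> {\<omega> \<in> space M. lim (\<lambda>n. X n \<omega>) = 1} \<longleftrightarrow> \<omega> \<in> ?K"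
      using Xlim AE_space
    proof eventually_elim
      case (elim \<omega>)
      show ?case using limI[OF elim(1)] elim(2) by (auto simp: indicator_def split: if_splits)
    qed
  qed auto
  have "(\<lambda>n. \<integral>\<omega>. X n \<omega> \<partial>M) \<longlonglongrightarrow> (\<integral>\<omega>. indicator ?K \<omega> \<partial>M)"
  proof (rule integral_dominated_convergence[where w = "\<lambda>_. 1"])
    show "AE \<omega> in M. norm (X n \<omega>) \<le> 1" for n by (intro AE_I2) (simp add: Xv indicator_def)
  qed (use K Xlim Xm in auto)
  moreover have "(\<lambda>n. \<integral>\<omega>. Y n \<omega> \<partial>M) \<longlonglongrightarrow> (\<integral>\<omega>. \<pi> (L \<omega>) \<partial>M)"
  proof (rule integral_dominated_convergence[where w = "\<lambda>_. 1"])
    show "AE \<omega> in M. norm (Y n \<omega>) \<le> 1" for n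
      by (intro AE_I2) (simp add: Yv \<pi>(2,3) d_def a0)
    show "AE \<omega> in M. (\<lambda>n. Y n \<omega>) \<longlonglongrightarrow> \<pi> (L \<omega>)"
      using L(2) AE_space
    proof eventually_elim
      case (elim \<omega>)
      have "(\<lambda>n. \<pi> (d n (L \<omega>))) \<longlonglongrightarrow> \<pi> (L \<omega>)"
        using \<pi>(1) d_lim[OF elim(1)] by (intro isCont_tendsto_compose[where g = \<pi>]) (auto simp: continuous_on_eq_continuous_at)
      thus ?case using elim(2) by (simp add: Yv)
    qed
  qed auto
  ultimately have "(\<integral>\<omega>. indicator ?K \<omega> \<partial>M) = (\<integral>\<omega>. \<pi> (L \<omega>) \<partial>M)"
    unfolding XY by (rule LIMSEQ_unique)
  thus ?thesis using K by (simp add: sets.Int_space_eq2)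
qed

section \<open>The generating series of the fractional Poisson probabilities\<close>

text \<open>Both sides are the reciprocal polynomials of those in the assumption: substitute \<open>1/x\<close> and multiply by \<open>x\<^sup>N\<close>.\<close>

lemma reversed_factorization:
  fixes \<mu> \<eta> :: "nat \<Rightarrow> real" and m :: "nat \<Rightarrow> nat"
  assumes N: "(\<Sum>j=1..M. m j) = N"
    and fac: "\<forall>x::real. (\<Sum>j=1..N. \<mu> j * x ^ j) + \<Lambda> = (\<Prod>j=1..M. (x - \<eta> j) ^ m j)"
  shows "(\<Sum>j=1..N. fps_const (\<mu> j) * fps_X ^ (N - j)) + fps_const \<Lambda> * fps_X ^ N
     = (\<Prod>j=1..M. (1 - fps_const (\<eta> j) * fps_X) ^ m j)"
proof -
  define p where "p = (\<Sum>j=1..N. monom (\<mu> j) (N - j)) + monom \<Lambda> N"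
  define q where "q = (\<Prod>j=1..M. [:1, - \<eta> j:] ^ m j)"
  have "poly p x = poly q x" if x: "x \<noteq> 0" for x
  proof -
    have "poly p x = (\<Sum>j=1..N. \<mu> j * x ^ (N - j)) + \<Lambda> * x ^ N"
      by (simp add: p_def poly_sum poly_monom)
    also have "(\<Sum>j=1..N. \<mu> j * x ^ (N - j)) = x ^ N * (\<Sum>j=1..N. \<mu> j * (1 / x) ^ j)"
      unfolding sum_distrib_left using x
      by (intro sum.cong) (auto simp: power_diff power_one_over field_simps)
    also have "\<dots> + \<Lambda> * x ^ N = x ^ N * ((\<Sum>j=1..N. \<mu> j * (1 / x) ^ j) + \<Lambda>)" by (simp add: algebra_simps)
    also have "\<dots> = (\<Prod>j=1..M. x ^ m j) * (\<Prod>j=1..M. (1 / x - \<eta> j) ^ m j)"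
      by (simp only: fac[THEN spec] power_sum[symmetric] N)
    also have "\<dots> = (\<Prod>j=1..M. (x * (1 / x - \<eta> j)) ^ m j)"
      by (simp add: prod.distrib power_mult_distrib)
    also have "\<dots> = poly q x" using x by (simp add: q_def poly_prod poly_power right_diff_distrib)
    finally show ?thesis .
  qed
  hence "- {0} \<subseteq> {x. poly (p - q) x = 0}" by auto
  moreover have "infinite (- {0 :: real})" by (simp add: infinite_UNIV_char_0)
  ultimately have "p - q = 0" using poly_roots_finite[of "p - q"] finite_subset by blast
  hence "fps_of_poly p = fps_of_poly q" by simp
  thus ?thesis
    by (simp add: p_def q_def fps_of_poly_add fps_of_poly_sum fps_of_poly_monom fps_of_poly_prod fps_of_poly_power fps_of_poly_pCons
        flip: fps_const_neg)
qed

text \<open>Multiplication by \<open>x\<^sup>N\<close> clears the divisions by \<open>x\<^sup>j\<close> in the image of \<open>\<Sum>\<^sub>j \<mu>\<^sub>j D\<^bsup>j\<nu>\<^esup>\<close>.\<close>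

lemma sum_shift_cancel:
  fixes \<phi> B :: "real fps"
  assumes B: "B = (\<Sum>j=1..N. fps_const (\<mu> j) * fps_X ^ (N - j))"
    and z: "\<And>n. 1 \<le> n \<Longrightarrow> n < N \<Longrightarrow> fps_nth \<phi> n = 0"
  shows "fps_X ^ N * (\<Sum>j=1..N. fps_const (\<mu> j) * fps_shift j \<phi>) = B * (\<phi> - fps_const (fps_nth \<phi> 0))"
proof -
  have "fps_X ^ N * (fps_const (\<mu> j) * fps_shift j \<phi>) = fps_const (\<mu> j) * fps_X ^ (N - j) * (\<phi> - fps_const (fps_nth \<phi> 0))"
    if j: "j \<in> {1..N}" for j
  proof -
    have "fps_X ^ j * fps_shift j \<phi> = \<phi> - fps_const (fps_nth \<phi> 0)"
      using j z by (intro fps_ext) (auto simp: fps_X_power_mult_nth)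
    moreover have XN: "fps_X ^ N = (fps_X ^ (N - j) * fps_X ^ j :: real fps)"
      using j by (simp add: power_add[symmetric])
    have "fps_X ^ N * (fps_const (\<mu> j) * fps_shift j \<phi>) =
        fps_const (\<mu> j) * fps_X ^ (N - j) * (fps_X ^ j * fps_shift j \<phi>)"
      unfolding XN by (simp only: mult_ac)
    ultimately show ?thesis by (simp only:)
  qed
  thus ?thesis unfolding B sum_distrib_left sum_distrib_right by (intro sum.cong) auto
qed

locale fractional_poisson_series =
  fixes N M :: nat and \<nu> \<Lambda> :: real and \<mu> \<eta> :: "nat \<Rightarrow> real" and m :: "nat \<Rightarrow> nat"
  assumes N1: "N \<ge> 1" and \<nu>0: "0 < \<nu>" and \<nu>N: "\<nu> \<le> 1 / real N" and \<Lambda>0: "\<Lambda> > 0"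
    and \<mu>0: "\<forall>j\<in>{1..N}. \<mu> j \<ge> 0"
    and m1: "\<forall>j\<in>{1..M}. m j \<ge> 1" and mN: "(\<Sum>j=1..M. m j) = N"
    and fac: "\<forall>x::real. (\<Sum>j=1..N. \<mu> j * x ^ j) + \<Lambda> = (\<Prod>j=1..M. (x - \<eta> j) ^ m j)"
begin

definition B :: "real fps" where "B = (\<Sum>j=1..N. fps_const (\<mu> j) * fps_X ^ (N - j))"

definition Q :: "real fps" where "Q = B + fps_const \<Lambda> * fps_X ^ N"

definition \<psi> :: "nat \<Rightarrow> real fps" where "\<psi> k = (fps_const \<Lambda> * fps_X ^ N * inverse Q) ^ Suc k"

definition \<phi> :: "nat \<Rightarrow> real fps" where
  "\<phi> k = (fps_const \<Lambda> * fps_X ^ N) ^ k * B * inverse Q ^ Suc k"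

definition laplace_exponent :: "real \<Rightarrow> real" where
  "laplace_exponent l = (\<Sum>j=1..N. \<mu> j * l powr (real j * \<nu>))"

lemma Q_eq_prod: "Q = (\<Prod>j=1..M. (1 - fps_const (\<eta> j) * fps_X) ^ m j)"
  unfolding Q_def B_def by (rule reversed_factorization[OF mN fac])

lemma Q_nth_0: "fps_nth Q 0 = 1"
proof -
  have "fps_nth (\<Prod>j\<in>J. (1 - fps_const (\<eta> j) * fps_X) ^ m j) 0 = 1" for J
    by (induction J rule: infinite_finite_induct) (simp_all add: fps_power_zeroth)
  thus ?thesis by (simp only: Q_eq_prod)
qed

lemma B_nth_0: "fps_nth B 0 = 1"
  using Q_nth_0 N1 by (simp add: Q_def)

text \<open>The product on the right of the factorisation is monic.\<close>

lemma \<mu>_N: "\<mu> N = 1"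
proof -
  have "fps_nth B 0 = (\<Sum>j=1..N. if j = N then \<mu> j else 0)"
    unfolding B_def fps_sum_nth by (intro sum.cong) (auto simp: fps_X_power_nth)
  also have "\<dots> = \<mu> N" using N1 by (subst sum.delta) auto
  finally show ?thesis using B_nth_0 by simp
qed

lemma Q_inverse: "Q * inverse Q = 1"
  using Q_nth_0 by (intro inverse_mult_eq_1') simp

lemma order_bounds: "j \<in> {1..N} \<Longrightarrow> 0 < real j * \<nu> \<and> real j * \<nu> \<le> 1"
proof -
  assume j: "j \<in> {1..N}"
  have "real j * \<nu> \<le> real N * (1 / real N)" using j \<nu>0 \<nu>N by (intro mult_mono) auto
  thus ?thesis using j \<nu>0 N1 by simp
qed

lemma laplace_exponent_pos: "l > 0 \<Longrightarrow> laplace_exponent l > 0"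
  unfolding laplace_exponent_def using \<mu>0 N1 \<mu>_N
  by (intro sum_pos2[of _ N]) auto

lemma radius_X: "fps_conv_radius (fps_const c * fps_X ^ n :: real fps) = \<infinity>"
  using fps_conv_radius_mult[of "fps_const c" "fps_X ^ n :: real fps"] by simp

lemma radius_B: "fps_conv_radius B = \<infinity>"
proof -
  have "fps_conv_radius (fps_of_poly (\<Sum>j=1..N. monom (\<mu> j) (N - j))) = \<infinity>" by simp
  thus ?thesis by (simp add: B_def fps_of_poly_sum fps_of_poly_monom)
qed

lemma radius_Q: "fps_conv_radius Q = \<infinity>"
  using fps_conv_radius_add[of B "fps_const \<Lambda> * fps_X ^ N"] by (simp add: Q_def radius_X radius_B)

lemma radius_inverse_Q: "fps_conv_radius (inverse Q) > 0"
  using Q_nth_0 by (intro fps_conv_radius_inverse_pos) (simp_all add: radius_Q)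

lemma radius_\<psi>: "fps_conv_radius (\<psi> k) > 0"
  unfolding \<psi>_def by (intro conv_radius_pos_power conv_radius_pos_mult radius_inverse_Q) (simp_all)

lemma radius_\<phi>: "fps_conv_radius (\<phi> k) > 0"
  unfolding \<phi>_def by (intro conv_radius_pos_power conv_radius_pos_mult radius_inverse_Q) (simp_all add: radius_B)

lemma \<phi>_0: "\<phi> 0 + fps_const 1 * \<psi> 0 = 1"
  using Q_inverse by (simp add: \<phi>_def \<psi>_def Q_def algebra_simps)

lemma \<phi>_Suc: "\<phi> (Suc k) + fps_const 1 * \<psi> (Suc k) = \<psi> k"
proof -
  let ?X = "fps_const \<Lambda> * fps_X ^ N"
  have "\<phi> (Suc k) + \<psi> (Suc k) = (?X * inverse Q) ^ Suc k * ((B + ?X) * inverse Q)"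
    by (simp add: \<phi>_def \<psi>_def power_mult_distrib algebra_simps)
  thus ?thesis using Q_inverse by (simp add: \<psi>_def Q_def)
qed

lemma Q_\<phi>_0: "Q * \<phi> 0 = B"
  using Q_inverse by (simp add: \<phi>_def mult.left_commute[of Q])

lemma Q_\<phi>_Suc: "Q * \<phi> (Suc k) = fps_const \<Lambda> * fps_X ^ N * \<phi> k"
proof -
  have "Q * \<phi> (Suc k) = (Q * inverse Q) * (fps_const \<Lambda> * fps_X ^ N * \<phi> k)"
    by (simp add: \<phi>_def mult_ac)
  thus ?thesis by (simp add: Q_inverse)
qed

lemma \<phi>_nth_0: "fps_nth (\<phi> k) 0 = (if k = 0 then 1 else 0)"
  using N1 B_nth_0 Q_nth_0 by (cases k) (simp_all add: \<phi>_def fps_power_zeroth mult.assoc)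

lemma \<phi>_nth_low: "fps_nth (\<phi> k) n = 0" if "1 \<le> n" "n < N"
proof (cases k)
  case 0
  have "\<phi> 0 = 1 - fps_X ^ N * (fps_const \<Lambda> * inverse Q)"
    using \<phi>_0 by (simp add: \<psi>_def algebra_simps)
  thus ?thesis using that 0 by (simp add: fps_X_power_mult_nth)
next
  case (Suc k')
  have "\<phi> k = fps_X ^ N * (fps_const \<Lambda> * (fps_const \<Lambda> * fps_X ^ N) ^ k' * B * inverse Q ^ Suc k)"
    by (simp add: \<phi>_def Suc mult_ac)
  thus ?thesis using that by (simp add: fps_X_power_mult_nth del: power_Suc)
qed

text \<open>The fractional equation at the level of power series.  After multiplication by \<open>x\<^sup>N\<close> both sides equal
  \<open>B (\<phi>\<^sub>k - \<phi>\<^sub>k(0))\<close>, since \<open>Q \<phi>\<^sub>k = \<Lambda> x\<^sup>N \<phi>\<^bsub>k-1\<^esub>\<close> and \<open>Q \<phi>\<^sub>0 = B\<close>.\<close>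

lemma shift_identity:
  "(\<Sum>j=1..N. fps_const (\<mu> j) * fps_shift j (\<phi> k)) =
     fps_const (- \<Lambda>) * \<phi> k + fps_const (if k = 0 then 0 else \<Lambda>) * \<phi> (k - 1)"
    (is "?L = ?R")
proof -
  have "fps_X ^ N * ?L = B * (\<phi> k - fps_const (fps_nth (\<phi> k) 0))"
    by (rule sum_shift_cancel[OF B_def \<phi>_nth_low])
  also have "\<dots> = fps_X ^ N * ?R"
  proof (cases k)
    case 0
    have "B * \<phi> 0 = B - fps_const \<Lambda> * fps_X ^ N * \<phi> 0"
      using Q_\<phi>_0 by (simp add: Q_def algebra_simps)
    thus ?thesis by (simp add: 0 \<phi>_nth_0 algebra_simps flip: fps_const_neg)
  next
    case (Suc k')
    have "B * \<phi> k = fps_const \<Lambda> * fps_X ^ N * \<phi> k' - fps_const \<Lambda> * fps_X ^ N * \<phi> k"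
      using Q_\<phi>_Suc[of k'] by (simp add: Q_def Suc algebra_simps)
    thus ?thesis by (simp add: Suc \<phi>_nth_0 algebra_simps flip: fps_const_neg)
  qed
  finally show ?thesis by simp
qed

lemma caputo_\<phi>:
  assumes t: "t > 0"
  shows "j \<in> {1..N} \<Longrightarrow> caputo_differentiable (real j * \<nu>) (borel_transform \<nu> (\<phi> k)) t"
    and "(\<Sum>j=1..N. \<mu> j * caputo_deriv (real j * \<nu>) (borel_transform \<nu> (\<phi> k)) t) =
      - \<Lambda> * (borel_transform \<nu> (\<phi> k) t - (if k = 0 then 0 else borel_transform \<nu> (\<phi> (k - 1)) t))"
proof -
  have C: "caputo_differentiable (real j * \<nu>) (borel_transform \<nu> (\<phi> k)) t"
    "caputo_deriv (real j * \<nu>) (borel_transform \<nu> (\<phi> k)) t = borel_transform \<nu> (fps_shift j (\<phi> k)) t"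
    if j: "j \<in> {1..N}" for j
    using caputo_borel_transform[OF \<nu>0 _ _ radius_\<phi>, of j k t] order_bounds[OF j] j t \<phi>_nth_low by auto
  thus "j \<in> {1..N} \<Longrightarrow> caputo_differentiable (real j * \<nu>) (borel_transform \<nu> (\<phi> k)) t" by blast
  have inf: "(0 :: ereal) < \<infinity>" by simp
  have "(\<Sum>j=1..N. \<mu> j * caputo_deriv (real j * \<nu>) (borel_transform \<nu> (\<phi> k)) t) =
     (\<Sum>j=1..N. \<mu> j * borel_transform \<nu> (fps_shift j (\<phi> k)) t)"
    by (intro sum.cong) (auto simp: C)
  also have "\<dots> = borel_transform \<nu> (\<Sum>j=1..N. fps_const (\<mu> j) * fps_shift j (\<phi> k)) t"
    by (rule borel_transform_sum[symmetric, OF \<nu>0]) (simp_all add: radius_\<phi>)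
  also have "\<dots> = - \<Lambda> * borel_transform \<nu> (\<phi> k) t + (if k = 0 then 0 else \<Lambda>) * borel_transform \<nu> (\<phi> (k - 1)) t"
    unfolding shift_identity
    by (simp only: borel_transform_add[OF \<nu>0] borel_transform_cmult[OF \<nu>0] conv_radius_pos_mult radius_\<phi> fps_conv_radius_const inf)
  finally show "(\<Sum>j=1..N. \<mu> j * caputo_deriv (real j * \<nu>) (borel_transform \<nu> (\<phi> k)) t) =
      - \<Lambda> * (borel_transform \<nu> (\<phi> k) t - (if k = 0 then 0 else borel_transform \<nu> (\<phi> (k - 1)) t))"
    by (simp add: algebra_simps)
qed

text \<open>Expand \<open>B\<close> in \<open>\<phi>\<^sub>k = \<Lambda>\<^sup>k x\<^bsup>Nk\<^esup> B Q\<^bsup>-(k+1)\<^esup>\<close>: each monomial of \<open>B\<close> contributes one Mittag-Leffler function.\<close>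

lemma borel_transform_\<phi>_eq_mittag_leffler:
  fixes k :: nat
  assumes t: "t \<ge> 0"
  defines "\<delta> \<equiv> \<lambda>j. \<nu> * (real N * (real k + 1) - real j) + 1"
  shows "borel_transform \<nu> (\<phi> k) t = \<Lambda> ^ k * (\<Sum>j=1..N. \<mu> j * rpow t (\<delta> j - 1) *
      mittag_leffler \<nu> (\<delta> j) M (\<lambda>i. real (m i * (k + 1))) (\<lambda>i. \<eta> i * rpow t \<nu>))"
proof -
  define W where "W = (\<Prod>i=1..M. inverse ((1 - fps_const (\<eta> i) * fps_X) ^ (m i * (k + 1))))"
  have W: "W = inverse Q ^ Suc k"
  proof -
    have "inverse (\<Prod>i\<in>J. f i) = (\<Prod>i\<in>J. inverse (f i))" for J and f :: "nat \<Rightarrow> real fps"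
      by (induction J rule: infinite_finite_induct) (simp_all add: fps_inverse_mult)
    thus ?thesis
      unfolding W_def Q_eq_prod fps_inverse_power[symmetric] prod_power_distrib
      by (simp only: power_mult Suc_eq_plus1)
  qed
  have summand: "rpow t (\<delta> j - 1) * mittag_leffler \<nu> (\<delta> j) M (\<lambda>i. real (m i * (k + 1))) (\<lambda>i. \<eta> i * rpow t \<nu>)
      = borel_transform \<nu> (fps_X ^ (N * Suc k - j) * W) t" if j: "j \<in> {1..N}" for j
  proof -
    have "j \<le> N * Suc k" using j by (auto intro: order_trans)
    hence "real (N * Suc k - j) = real N * (real k + 1) - real j"
      by (simp add: of_nat_diff algebra_simps)
    hence \<delta>: "\<delta> j = \<nu> * real (N * Suc k - j) + 1" by (simp only: \<delta>_def)
    show ?thesis unfolding \<delta> W_def add_diff_cancel_right'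
      using m1 by (intro mittag_leffler_eq_borel_transform \<nu>0 t) force
  qed
  have \<phi>: "\<phi> k = (\<Sum>j=1..N. fps_const (\<Lambda> ^ k * \<mu> j) * (fps_X ^ (N * Suc k - j) * W))"
  proof -
    have "\<phi> k = (\<Sum>j=1..N. (fps_const \<Lambda> * fps_X ^ N) ^ k * (fps_const (\<mu> j) * fps_X ^ (N - j)) * W)"
      unfolding \<phi>_def B_def W sum_distrib_left sum_distrib_right ..
    also have "\<dots> = (\<Sum>j=1..N. fps_const (\<Lambda> ^ k * \<mu> j) * (fps_X ^ (N * Suc k - j) * W))"
    proof (rule sum.cong)
      fix j assume j: "j \<in> {1..N}"
      have "N * Suc k - j = N * k + (N - j)" using j by simp
      hence "fps_X ^ (N * Suc k - j) = (fps_X ^ N) ^ k * (fps_X ^ (N - j) :: real fps)"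
        by (simp only: power_add power_mult)
      thus "(fps_const \<Lambda> * fps_X ^ N) ^ k * (fps_const (\<mu> j) * fps_X ^ (N - j)) * W =
         fps_const (\<Lambda> ^ k * \<mu> j) * (fps_X ^ (N * Suc k - j) * W)"
        by (simp add: power_mult_distrib mult_ac flip: fps_const_mult fps_const_power)
    qed simp
    finally show ?thesis .
  qed
  have "borel_transform \<nu> (\<phi> k) t = (\<Sum>j=1..N. \<Lambda> ^ k * \<mu> j * borel_transform \<nu> (fps_X ^ (N * Suc k - j) * W) t)"
    unfolding \<phi>
    by (rule borel_transform_sum[OF \<nu>0])
       (auto simp: W intro!: conv_radius_pos_mult conv_radius_pos_power radius_inverse_Q)
  also have "\<dots> = \<Lambda> ^ k * (\<Sum>j=1..N. \<mu> j * rpow t (\<delta> j - 1) *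
      mittag_leffler \<nu> (\<delta> j) M (\<lambda>i. real (m i * (k + 1))) (\<lambda>i. \<eta> i * rpow t \<nu>))"
    unfolding sum_distrib_left by (intro sum.cong refl) (simp only: summand[symmetric] mult.assoc)
  finally show ?thesis .
qed

text \<open>At \<open>x = \<lambda>\<^bsup>-\<nu>\<^esup>\<close> one has \<open>B(x) = x\<^sup>N f(\<lambda>)\<close>, hence \<open>Q(x) = x\<^sup>N (\<Lambda> + f(\<lambda>))\<close>.  The series converge there only for
  large \<open>\<lambda>\<close>, which is enough for uniqueness.\<close>

lemma eval_\<psi>:
  obtains l0 where "l0 > 0"
    "\<And>l. l \<ge> l0 \<Longrightarrow> ereal (l powr (- \<nu>)) < fps_conv_radius (\<psi> k)"
    "\<And>l. l \<ge> l0 \<Longrightarrow> eval_fps (\<psi> k) (l powr (- \<nu>)) = (\<Lambda> / (\<Lambda> + laplace_exponent l)) ^ Suc k"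
proof -
  let ?R = "min (fps_conv_radius (inverse Q)) (fps_conv_radius (\<psi> k))"
  have "?R > 0" using radius_inverse_Q radius_\<psi> by simp
  then obtain r where r: "0 < r" "ereal r < ?R" using ereal_dense2[of 0 ?R] by auto
  \<comment> \<open>the value of \<open>l\<close> at which \<open>l\<^bsup>-\<nu>\<^esup> = r\<close>\<close>
  define l0 where "l0 = r powr (- 1 / \<nu>)"
  have l0: "l0 > 0" using r by (simp add: l0_def)
  have le: "l powr (- \<nu>) \<le> r" if "l \<ge> l0" for l
  proof -
    have "l powr (- \<nu>) \<le> l0 powr (- \<nu>)" using that l0 \<nu>0 by (intro powr_mono2') auto
    also have "\<dots> = r" using r \<nu>0 by (simp add: l0_def powr_powr)
    finally show ?thesis .
  qed
  have lt: "ereal (l powr (- \<nu>)) < fps_conv_radius (\<psi> k)" "ereal (l powr (- \<nu>)) < fps_conv_radius (inverse Q)" if "l \<ge> l0" for l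
    using le_less_trans[OF _ r(2), of "ereal (l powr (- \<nu>))"] le[OF that] by auto
  moreover have "eval_fps (\<psi> k) (l powr (- \<nu>)) = (\<Lambda> / (\<Lambda> + laplace_exponent l)) ^ Suc k" if l: "l \<ge> l0" for l
  proof -
    define x where "x = l powr (- \<nu>)"
    have l': "l > 0" using l l0 by simp
    have x: "x > 0" using l' by (simp add: x_def)
    have rad: "ereal (norm x) < fps_conv_radius (inverse Q)" using lt(2)[OF l] x by (simp add: x_def)
    have radX: "ereal (norm x) < fps_conv_radius (fps_const \<Lambda> * fps_X ^ N :: real fps)" by (simp add: radius_X)
    have "eval_fps B x = x ^ N * laplace_exponent l"
    proof -
      have "eval_fps B x = eval_fps (fps_of_poly (\<Sum>j=1..N. monom (\<mu> j) (N - j))) x"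
        by (simp add: B_def fps_of_poly_sum fps_of_poly_monom)
      also have "\<dots> = (\<Sum>j=1..N. \<mu> j * x ^ (N - j))" by (simp add: poly_sum poly_monom)
      also have "\<dots> = (\<Sum>j=1..N. x ^ N * (\<mu> j * l powr (real j * \<nu>)))"
      proof (rule sum.cong)
        fix j assume j: "j \<in> {1..N}"
        have "x ^ j * l powr (real j * \<nu>) = 1"
          using l' by (simp add: x_def powr_power_eq powr_add[symmetric] mult.commute)
        moreover have "x ^ N = x ^ (N - j) * x ^ j" using j by (simp add: power_add[symmetric])
        ultimately show "\<mu> j * x ^ (N - j) = x ^ N * (\<mu> j * l powr (real j * \<nu>))" by simp
      qed simp
      finally show ?thesis by (simp add: laplace_exponent_def sum_distrib_left)
    qed
    moreover have evX: "eval_fps (fps_const \<Lambda> * fps_X ^ N) x = \<Lambda> * x ^ N"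
      by (subst eval_fps_mult) simp_all
    moreover have "eval_fps Q x = eval_fps B x + eval_fps (fps_const \<Lambda> * fps_X ^ N) x"
      unfolding Q_def by (rule eval_fps_add) (simp_all add: radius_B radius_X)
    ultimately have "eval_fps Q x = x ^ N * (\<Lambda> + laplace_exponent l)" by (simp add: algebra_simps)
    moreover have "eval_fps Q x * eval_fps (inverse Q) x = 1"
      using eval_fps_mult[of x Q "inverse Q"] rad by (simp add: radius_Q Q_inverse)
    moreover have pos: "x ^ N > 0" "\<Lambda> + laplace_exponent l > 0"
      using x \<Lambda>0 laplace_exponent_pos[OF l'] by simp_all
    ultimately have inv: "\<Lambda> * x ^ N * eval_fps (inverse Q) x = \<Lambda> / (\<Lambda> + laplace_exponent l)"
      by (simp add: field_simps)
    have "ereal (norm x) < fps_conv_radius (fps_const \<Lambda> * fps_X ^ N * inverse Q)"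
      using fps_conv_radius_mult[of "fps_const \<Lambda> * fps_X ^ N" "inverse Q"] rad
      by (simp add: radius_X less_le_trans)
    hence "eval_fps (\<psi> k) x = eval_fps (fps_const \<Lambda> * fps_X ^ N * inverse Q) x ^ Suc k"
      unfolding \<psi>_def by (rule eval_fps_power)
    also have "eval_fps (fps_const \<Lambda> * fps_X ^ N * inverse Q) x = \<Lambda> * x ^ N * eval_fps (inverse Q) x"
      using eval_fps_mult[OF radX rad] evX by simp
    finally have "eval_fps (\<psi> k) x = (\<Lambda> / (\<Lambda> + laplace_exponent l)) ^ Suc k" unfolding inv .
    thus ?thesis by (simp only: x_def)
  qed
  ultimately show ?thesis using that[OF l0] by blast
qed

text \<open>Both functions have the Laplace transform \<open>(\<Lambda> / (\<Lambda> + f(\<lambda>)))\<^bsup>k+1\<^esup> / \<lambda>\<close> for large \<open>\<lambda>\<close>.  Continuity of the right-hand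
  side then shows that the mixture has no atom at \<open>t\<close>, so the open half-line may replace the closed one.\<close>

lemma erlang_mixture_cdf:
  assumes S: "laplace_subordinator Mw S laplace_exponent" and t: "t > 0"
  shows "measure (laplace_subordinator.erlang_mixture Mw S k \<Lambda>) {..<t} = borel_transform \<nu> (\<psi> k) t"
proof -
  interpret S: laplace_subordinator Mw S laplace_exponent by fact
  let ?\<rho> = "S.erlang_mixture k \<Lambda>"
  interpret X: real_distribution ?\<rho> by (rule S.real_distribution_erlang_mixture[OF \<Lambda>0])
  obtain l0 where l0: "l0 > 0"
    "\<And>l. l \<ge> l0 \<Longrightarrow> ereal (l powr (- \<nu>)) < fps_conv_radius (\<psi> k)"
    "\<And>l. l \<ge> l0 \<Longrightarrow> eval_fps (\<psi> k) (l powr (- \<nu>)) = (\<Lambda> / (\<Lambda> + laplace_exponent l)) ^ Suc k"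
    using eval_\<psi>[of k] by metis
  define h where "h t = cdf ?\<rho> t - borel_transform \<nu> (\<psi> k) t" for t
  have contT: "isCont (borel_transform \<nu> (\<psi> k)) t" if "t > 0" for t
    using continuous_on_interior[OF continuous_on_borel_transform[OF \<nu>0 radius_\<psi>]] that
    by (simp add: interior_Ici[of "- 1"])
  have h0: "h t = 0" if t: "t > 0" for t
  proof (rule laplace_transform_unique[OF _ _ t])
    show "continuous (at_right t) h" if "t > 0" for t
      unfolding h_def using contT[OF that] X.cdf_is_right_cont
      by (intro continuous_diff) (auto intro: continuous_at_imp_continuous_at_within)
    fix l assume l: "l \<ge> l0"
    have l': "l > 0" using l l0 by simp
    have "0 \<le> (\<Lambda> / (\<Lambda> + laplace_exponent l)) ^ Suc k"
      using \<Lambda>0 laplace_exponent_pos[OF l'] by simp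
    hence "has_bochner_integral lborel (\<lambda>t. indicator {0<..} t * (exp (- l * t) * cdf ?\<rho> t)) ((\<Lambda> / (\<Lambda> + laplace_exponent l)) ^ Suc k / l)"
      by (intro laplace_cdf X.real_distribution_axioms S.erlang_mixture_nonneg S.laplace_erlang_mixture \<Lambda>0 l')
    moreover have "has_bochner_integral lborel (\<lambda>t. indicator {0<..} t * (exp (- l * t) * borel_transform \<nu> (\<psi> k) t)) ((\<Lambda> / (\<Lambda> + laplace_exponent l)) ^ Suc k / l)"
      using laplace_borel_transform[OF \<nu>0 l' l0(2)[OF l]] unfolding l0(3)[OF l] .
    ultimately have "has_bochner_integral lborel (\<lambda>t. indicator {0<..} t * (exp (- l * t) * cdf ?\<rho> t) -
        indicator {0<..} t * (exp (- l * t) * borel_transform \<nu> (\<psi> k) t)) 0"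
      using has_bochner_integral_diff by fastforce
    thus "has_bochner_integral lborel (\<lambda>t. indicator {0<..} t * (exp (- l * t) * h t)) 0"
      by (simp add: h_def right_diff_distrib)
  qed
  hence eq: "cdf ?\<rho> s = borel_transform \<nu> (\<psi> k) s" if "s > 0" for s using that by (simp add: h_def)
  have "isCont (cdf ?\<rho>) t"
  proof -
    have "eventually (\<lambda>s. s \<in> {0<..}) (nhds t)" using t by (intro eventually_nhds_in_open) auto
    hence "eventually (\<lambda>s. cdf ?\<rho> s = borel_transform \<nu> (\<psi> k) s) (nhds t)"
      by eventually_elim (simp add: eq)
    from isCont_cong[OF this] show ?thesis using contT[OF t] by simp
  qed
  hence "measure ?\<rho> {t} = 0" by (simp add: X.isCont_cdf)
  moreover have "measure ?\<rho> ({..<t} \<union> {t}) = measure ?\<rho> {..<t} + measure ?\<rho> {t}"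
    by (rule X.finite_measure_Union) auto
  moreover have "{..<t} \<union> {t} = {..t}" by auto
  ultimately show ?thesis using eq[OF t] by (simp add: cdf_def)
qed

end

section \<open>The time-changed Poisson process\<close>

text \<open>The degenerate order \<open>1\<close>, where the process is deterministic drift, satisfies the same laws as the proper stable
  subordinators, and the rest of the argument does not distinguish the two cases.\<close>

lemma stable_subordinatorD:
  assumes M: "prob_space M" and H: "stable_subordinator M \<beta> H"
  shows "0 \<le> s \<Longrightarrow> H s \<in> borel_measurable M"
    and "AE \<omega> in M. mono_on {0..} (\<lambda>s. H s \<omega>)"
    and "AE \<omega> in M. H 0 \<omega> = 0"
    and "0 \<le> s \<Longrightarrow> 0 < l \<Longrightarrow> (\<integral>\<omega>. exp (- l * H s \<omega>) \<partial>M) = exp (- s * l powr \<beta>)"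
proof -
  interpret prob_space M by fact
  consider "\<beta> = 1" "\<And>s \<omega>. 0 \<le> s \<Longrightarrow> \<omega> \<in> space M \<Longrightarrow> H s \<omega> = s"
    | "levy_process M H" "AE \<omega> in M. mono_on {0..} (\<lambda>s. H s \<omega>)"
      "\<And>s l. 0 \<le> s \<Longrightarrow> 0 < l \<Longrightarrow> (\<integral>\<omega>. exp (- l * H s \<omega>) \<partial>M) = exp (- s * l powr \<beta>)"
    using H by (auto simp: stable_subordinator_def split: if_splits)
  note cs = this
  show "H s \<in> borel_measurable M" if s: "0 \<le> s"
  proof (cases rule: cs)
    case 1
    have "(\<lambda>_. s) \<in> borel_measurable M" by simp
    thus ?thesis using 1(2)[OF s] by (subst measurable_cong[where g = "\<lambda>_. s"]) auto
  next
    case 2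
    thus ?thesis using s by (simp add: levy_process_def)
  qed
  show "AE \<omega> in M. mono_on {0..} (\<lambda>s. H s \<omega>)"
  proof (cases rule: cs)
    case 1
    show ?thesis by (intro AE_I2 mono_onI) (auto simp: 1(2))
  qed
  show "AE \<omega> in M. H 0 \<omega> = 0"
  proof (cases rule: cs)
    case 1
    show ?thesis by (intro AE_I2) (simp add: 1(2))
  next
    case 2
    thus ?thesis by (simp add: levy_process_def)
  qed
  show "(\<integral>\<omega>. exp (- l * H s \<omega>) \<partial>M) = exp (- s * l powr \<beta>)" if s: "0 \<le> s" and l: "0 < l"
  proof (cases rule: cs)
    case 1
    have "(\<integral>\<omega>. exp (- l * H s \<omega>) \<partial>M) = (\<integral>\<omega>. exp (- l * s) \<partial>M)"
      by (rule Bochner_Integration.integral_cong) (simp_all add: 1(2)[OF s])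
    thus ?thesis using 1(1) l by (simp add: prob_space mult.commute)
  next
    case 2
    show ?thesis by (rule 2(3)[OF s l])
  qed
qed

lemma laplace_subordinator_completion:
  assumes "laplace_subordinator M S f"
  shows "laplace_subordinator (completion M) S f"
proof -
  interpret laplace_subordinator M S f by fact
  interpret C: prob_space "completion M" by (rule prob_space_completion)
  show ?thesis
  proof
    show "S s \<in> borel_measurable (completion M)" if "0 \<le> s" for s
      by (rule measurable_completion[OF meas[OF that]])
    show "AE \<omega> in completion M. mono_on {0..} (\<lambda>s. S s \<omega>)" by (rule AE_completion[OF mono])
    show "AE \<omega> in completion M. 0 \<le> S 0 \<omega>" by (rule AE_completion[OF nonneg])
    show "(\<integral>\<omega>. exp (- l * S s \<omega>) \<partial>completion M) = exp (- s * f l)" if "0 \<le> s" "0 < l" for s l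
      using laplace[OF that] meas[OF that(1)] by (subst integral_completion) auto
    show "0 < f l" if "0 < l" for l by (rule f_pos[OF that])
  qed
qed

lemma measurable_coordinate: "0 \<le> (s :: real) \<Longrightarrow> (\<lambda>x. x s) \<in> path_space \<rightarrow>\<^sub>M borel"
  by (rule measurable_component_singleton) simp

text \<open>The scaling \<open>\<mu>\<^sub>j\<^bsup>1/\<beta>\<^sub>j\<^esup>\<close> turns \<open>\<lambda>\<^bsup>\<beta>\<^sub>j\<^esup>\<close> into \<open>\<mu>\<^sub>j \<lambda>\<^bsup>\<beta>\<^sub>j\<^esup>\<close>, and independence makes Laplace transforms multiply.\<close>

lemma laplace_subordinator_sum:
  fixes H :: "nat \<Rightarrow> real \<Rightarrow> 'w \<Rightarrow> real" and \<mu> \<beta> :: "nat \<Rightarrow> real"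
  assumes M: "prob_space M" and I: "finite I"
    and \<beta>: "\<And>j. j \<in> I \<Longrightarrow> \<beta> j > 0" and \<mu>: "\<And>j. j \<in> I \<Longrightarrow> \<mu> j \<ge> 0"
    and H: "\<And>j. j \<in> I \<Longrightarrow> stable_subordinator M (\<beta> j) (H j)"
    and ind: "prob_space.indep_vars M (\<lambda>_. path_space) (\<lambda>j. sample_path (H j)) I"
    and pos: "\<And>l. l > 0 \<Longrightarrow> (\<Sum>j\<in>I. \<mu> j * l powr \<beta> j) > 0"
  shows "laplace_subordinator M (\<lambda>s \<omega>. \<Sum>j\<in>I. \<mu> j powr (1 / \<beta> j) * H j s \<omega>) (\<lambda>l. \<Sum>j\<in>I. \<mu> j * l powr \<beta> j)"
proof -
  interpret prob_space M by fact
  define c where "c j = \<mu> j powr (1 / \<beta> j)" for j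
  have c: "c j \<ge> 0" for j by (simp add: c_def)
  note D = stable_subordinatorD[OF M H]
  have mono: "AE \<omega> in M. \<forall>j\<in>I. mono_on {0..} (\<lambda>s. H j s \<omega>)"
    by (rule AE_finite_allI[OF I D(2)])
  have zero: "AE \<omega> in M. \<forall>j\<in>I. H j 0 \<omega> = 0"
    by (rule AE_finite_allI[OF I D(3)])
  have one: "(\<integral>\<omega>. exp (- l * (c j * H j s \<omega>)) \<partial>M) = exp (- s * (\<mu> j * l powr \<beta> j))"
    if j: "j \<in> I" and s: "0 \<le> s" and l: "0 < l" for j s l
  proof (cases "\<mu> j = 0")
    case True
    thus ?thesis by (simp add: c_def prob_space)
  next
    case False
    hence p: "\<mu> j > 0" using \<mu>[OF j] by simp
    hence "c j > 0" by (simp add: c_def)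
    hence "(\<integral>\<omega>. exp (- (l * c j) * H j s \<omega>) \<partial>M) = exp (- s * (l * c j) powr \<beta> j)"
      using s l by (intro D(4)[OF j]) auto
    moreover have "(l * c j) powr \<beta> j = \<mu> j * l powr \<beta> j"
      using p l \<beta>[OF j] by (simp add: c_def powr_mult powr_powr)
    ultimately show ?thesis by (simp add: mult.assoc)
  qed
  have "laplace_subordinator M (\<lambda>s \<omega>. \<Sum>j\<in>I. c j * H j s \<omega>) (\<lambda>l. \<Sum>j\<in>I. \<mu> j * l powr \<beta> j)"
  proof
    show "(\<lambda>\<omega>. \<Sum>j\<in>I. c j * H j s \<omega>) \<in> borel_measurable M" if "0 \<le> s" for s
      using D(1) that by (intro borel_measurable_sum borel_measurable_times borel_measurable_const) auto
    show "AE \<omega> in M. mono_on {0..} (\<lambda>s. \<Sum>j\<in>I. c j * H j s \<omega>)"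
      using mono
    proof eventually_elim
      case (elim \<omega>)
      show ?case
      proof (intro mono_onI sum_mono mult_left_mono c)
        fix s s' :: real and j assume "s \<in> {0..}" "s' \<in> {0..}" "s \<le> s'" "j \<in> I"
        thus "H j s \<omega> \<le> H j s' \<omega>" using elim mono_onD by blast
      qed
    qed
    show "AE \<omega> in M. 0 \<le> (\<Sum>j\<in>I. c j * H j 0 \<omega>)"
      using zero by eventually_elim simp
    show "(\<integral>\<omega>. exp (- l * (\<Sum>j\<in>I. c j * H j s \<omega>)) \<partial>M) = exp (- s * (\<Sum>j\<in>I. \<mu> j * l powr \<beta> j))"
      if s: "0 \<le> s" and l: "0 < l" for s l
    proof -
      have "indep_vars (\<lambda>_. borel) (\<lambda>j \<omega>. exp (- l * (c j * (sample_path (H j) \<omega> s)))) I"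
        by (rule indep_vars_compose2[OF ind, where Y = "\<lambda>j x. exp (- l * (c j * x s))"])
           (rule measurable_compose[OF measurable_coordinate[OF s]], measurable)
      hence iv: "indep_vars (\<lambda>_. borel) (\<lambda>j \<omega>. exp (- l * (c j * H j s \<omega>))) I"
        using s by (simp add: sample_path_def)
      have int: "integrable M (\<lambda>\<omega>. exp (- l * (c j * H j s \<omega>)))" if "j \<in> I" for j
        using one[OF that s l] not_integrable_integral_eq by fastforce
      have "(\<integral>\<omega>. exp (- l * (\<Sum>j\<in>I. c j * H j s \<omega>)) \<partial>M) = (\<integral>\<omega>. (\<Prod>j\<in>I. exp (- l * (c j * H j s \<omega>))) \<partial>M)"
        unfolding sum_distrib_left exp_sum[OF I] ..
      also have "\<dots> = (\<Prod>j\<in>I. \<integral>\<omega>. exp (- l * (c j * H j s \<omega>)) \<partial>M)"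
        by (rule indep_vars_lebesgue_integral[OF I iv int])
      also have "\<dots> = (\<Prod>j\<in>I. exp (- s * (\<mu> j * l powr \<beta> j)))"
        by (intro prod.cong one s l) auto
      also have "\<dots> = exp (- s * (\<Sum>j\<in>I. \<mu> j * l powr \<beta> j))"
        unfolding sum_distrib_left exp_sum[OF I] ..
      finally show ?thesis .
    qed
    show "0 < (\<Sum>j\<in>I. \<mu> j * l powr \<beta> j)" if "0 < l" for l by (rule pos[OF that])
  qed
  thus ?thesis by (simp add: c_def)
qed

text \<open>Caputo derivatives at \<open>t\<close> see only the values on \<open>(0, \<infinity>)\<close>; the probabilities agree with the series on nonnegative
  times only.\<close>

lemma caputo_cong:
  assumes t: "t > 0" and eq: "\<And>s. s \<ge> 0 \<Longrightarrow> u s = v s"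
  shows "caputo_differentiable \<beta> u t \<longleftrightarrow> caputo_differentiable \<beta> v t"
    and "caputo_deriv \<beta> u t = caputo_deriv \<beta> v t"
proof -
  have ev: "eventually (\<lambda>x. u x = v x) (nhds s)" if "s > 0" for s
  proof -
    have "eventually (\<lambda>x. x \<in> {0<..}) (nhds s)" using that by (intro eventually_nhds_in_open) auto
    thus ?thesis by eventually_elim (simp add: eq)
  qed
  have D: "(u has_real_derivative d) (at s) \<longleftrightarrow> (v has_real_derivative d) (at s)" if "s > 0" for s d
    using DERIV_cong_ev[OF refl ev[OF that] refl] .
  have diff: "u differentiable (at s) \<longleftrightarrow> v differentiable (at s)" if "s > 0" for s
    unfolding real_differentiable_def using D[OF that] by blast
  have der: "deriv u s = deriv v s" if "s > 0" for s
    by (rule deriv_cong_ev[OF ev[OF that] refl])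
  have "set_integrable lborel {0<..<t} (\<lambda>s. deriv u s / (t - s) powr \<beta>) \<longleftrightarrow>
      set_integrable lborel {0<..<t} (\<lambda>s. deriv v s / (t - s) powr \<beta>)"
    by (intro set_integrable_cong refl) (auto simp: der)
  thus "caputo_differentiable \<beta> u t \<longleftrightarrow> caputo_differentiable \<beta> v t"
    using diff t by (auto simp: caputo_differentiable_def)
  have "(LBINT s:{0<..<t}. deriv u s / (t - s) powr \<beta>) = (LBINT s:{0<..<t}. deriv v s / (t - s) powr \<beta>)"
    by (intro set_lebesgue_integral_cong) (auto simp: der)
  thus "caputo_deriv \<beta> u t = caputo_deriv \<beta> v t"
    using der t by (simp add: caputo_deriv_def)
qed

text \<open>Conditioning on the operational time.\<close>

lemma time_changed_poisson_prob_eq: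
  fixes A :: "real \<Rightarrow> 'w \<Rightarrow> nat" and L :: "real \<Rightarrow> 'w \<Rightarrow> real"
  assumes P: "prob_space P" and A: "poisson_process P \<Lambda> A" and \<Lambda>: "\<Lambda> > 0" and t: "t \<ge> 0"
    and ind: "prob_space.indep_var (completion P)
           path_space (sample_path (\<lambda>t \<omega>. real (A t \<omega>))) path_space (sample_path L)"
    and L0: "AE \<omega> in completion P. 0 \<le> L t \<omega>"
  shows "has_bochner_integral (completion P) (\<lambda>\<omega>. exp (- \<Lambda> * L t \<omega>) * (\<Lambda> * L t \<omega>) ^ k / fact k)
     (measure (completion P) {\<omega> \<in> space P. A (L t \<omega>) \<omega> = k})"
    and "L t \<in> borel_measurable (completion P)"
proof -
  interpret P: prob_space P by fact
  interpret C: prob_space "completion P" by (rule P.prob_space_completion)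
  have lev: "levy_process P (\<lambda>t \<omega>. real (A t \<omega>))"
    and pk: "\<And>s k. 0 \<le> s \<Longrightarrow> measure P {\<omega> \<in> space P. A s \<omega> = k} = exp (- \<Lambda> * s) * (\<Lambda> * s) ^ k / fact k"
    using A by (auto simp: poisson_process_def)
  have Am: "(\<lambda>\<omega>. real (A s \<omega>)) \<in> borel_measurable P" if "0 \<le> s" for s
    using lev that by (simp add: levy_process_def)
  have rc: "AE \<omega> in P. \<forall>s\<ge>0. continuous (at_right s) (\<lambda>s. real (A s \<omega>))"
  proof -
    have "AE \<omega> in P. \<forall>t\<ge>0. continuous (at_right t) (\<lambda>s. real (A s \<omega>)) \<and>
        (t > 0 \<longrightarrow> (\<exists>l. ((\<lambda>s. real (A s \<omega>)) \<longlongrightarrow> l) (at_left t)))"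
      using lev unfolding levy_process_def by (elim conjE)
    thus ?thesis by eventually_elim blast
  qed
  have sp: "(\<lambda>x. x s) \<circ> sample_path X = X s" if "0 \<le> s" for X :: "real \<Rightarrow> 'w \<Rightarrow> real" and s
    using that by (simp add: sample_path_def fun_eq_iff)
  have ind': "C.indep_var borel (\<lambda>\<omega>. real (A s \<omega>)) borel (L t)" if "0 \<le> s" for s
    using C.indep_var_compose[OF ind measurable_coordinate[OF that] measurable_coordinate[OF t]]
    unfolding sp[OF that] sp[OF t] .
  show Lm: "L t \<in> borel_measurable (completion P)" using C.indep_var_rv2[OF ind'[of 0]] by simp
  have law: "measure (completion P) {\<omega> \<in> space (completion P). A s \<omega> = k} = exp (- \<Lambda> * s) * (\<Lambda> * s) ^ k / fact k" if "0 \<le> s" for s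
  proof -
    note [measurable] = Am[OF that]
    have "{\<omega> \<in> space P. real (A s \<omega>) = real k} \<in> sets P" by measurable
    thus ?thesis using pk[OF that, of k] by simp
  qed
  have bounds: "0 \<le> exp (- \<Lambda> * s) * (\<Lambda> * s) ^ k / fact k" "exp (- \<Lambda> * s) * (\<Lambda> * s) ^ k / fact k \<le> 1"
    if "0 \<le> s" for s
    unfolding law[OF that, symmetric] by simp_all
  have cont: "continuous_on UNIV (\<lambda>s. exp (- \<Lambda> * s) * (\<Lambda> * s) ^ k / fact k)"
    by (intro continuous_intros) simp
  have [measurable]: "(\<lambda>s. exp (- \<Lambda> * s) * (\<Lambda> * s) ^ k / fact k) \<in> borel_measurable borel"
    by (rule borel_measurable_continuous_onI[OF cont])
  have "measure (completion P) {\<omega> \<in> space (completion P). A (L t \<omega>) \<omega> = k} =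
      (\<integral>\<omega>. exp (- \<Lambda> * L t \<omega>) * (\<Lambda> * L t \<omega>) ^ k / fact k \<partial>completion P)"
    by (rule completion.prob_random_time[where \<pi> = "\<lambda>s. exp (- \<Lambda> * s) * (\<Lambda> * s) ^ k / fact k",
          OF C.prob_space_axioms measurable_completion[OF Am] AE_completion[OF rc] Lm L0 ind' law cont bounds])
  moreover have "integrable (completion P) (\<lambda>\<omega>. exp (- \<Lambda> * L t \<omega>) * (\<Lambda> * L t \<omega>) ^ k / fact k)"
  proof (rule C.integrable_const_bound[where B = 1])
    show "AE \<omega> in completion P. norm (exp (- \<Lambda> * L t \<omega>) * (\<Lambda> * L t \<omega>) ^ k / fact k) \<le> 1"
      using L0
    proof eventually_elim
      case (elim \<omega>)
      show ?case unfolding real_norm_def abs_of_nonneg[OF bounds(1)[OF elim]] by (rule bounds(2)[OF elim])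
    qed
    show "(\<lambda>\<omega>. exp (- \<Lambda> * L t \<omega>) * (\<Lambda> * L t \<omega>) ^ k / fact k) \<in> borel_measurable (completion P)"
      using Lm by measurable
  qed
  ultimately show "has_bochner_integral (completion P) (\<lambda>\<omega>. exp (- \<Lambda> * L t \<omega>) * (\<Lambda> * L t \<omega>) ^ k / fact k)
     (measure (completion P) {\<omega> \<in> space P. A (L t \<omega>) \<omega> = k})"
    by (simp add: has_bochner_integral_iff)
qed

theorem theorem14:
  fixes P :: "'w measure"
    and H :: "nat \<Rightarrow> real \<Rightarrow> 'w \<Rightarrow> real" and A :: "real \<Rightarrow> 'w \<Rightarrow> nat"
    and N M :: nat and \<nu> \<Lambda> :: real
    and \<mu> \<eta> :: "nat \<Rightarrow> real" and m :: "nat \<Rightarrow> nat"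
  assumes "prob_space P"
    and "N \<ge> 1" and "0 < \<nu>" and "\<nu> \<le> 1 / real N" and "\<Lambda> > 0"
    and "\<forall>j\<in>{1..N}. \<mu> j \<ge> 0"
    and "\<forall>j\<in>{1..M}. m j \<ge> 1" and "(\<Sum>j=1..M. m j) = N"
    and "\<forall>x::real. (\<Sum>j=1..N. \<mu> j * x ^ j) + \<Lambda> = (\<Prod>j=1..M. (x - \<eta> j) ^ m j)"
    and "\<forall>j\<in>{1..N}. stable_subordinator P (real j * \<nu>) (H j)"
    and "prob_space.indep_vars P (\<lambda>_. path_space) (\<lambda>j. sample_path (H j)) {1..N}"
    and "poisson_process P \<Lambda> A"
    and "prob_space.indep_var (completion P)
           path_space (sample_path (\<lambda>t \<omega>. real (A t \<omega>)))
           path_space (sample_path (inverse_process N \<nu> \<mu> H))"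
  shows "let p = time_changed_poisson_prob P N \<nu> \<mu> H A;
             \<gamma> = (\<lambda>k j. real (m j * (k + 1)));
             \<delta> = (\<lambda>k j. \<nu> * (real N * (real k + 1) - real j) + 1)
         in solves_fractional_poisson N \<nu> \<mu> \<Lambda> p \<and>
            (\<forall>k. \<forall>t\<ge>0. p k t =
               \<Lambda> ^ k * (\<Sum>j=1..N. \<mu> j * rpow t (\<delta> k j - 1) *
                 mittag_leffler \<nu> (\<delta> k j) M (\<gamma> k) (\<lambda>i. \<eta> i * rpow t \<nu>)))"
proof -
  interpret P: prob_space P by fact
  interpret C: prob_space "completion P" by (rule P.prob_space_completion)
  interpret F: fractional_poisson_series N M \<nu> \<Lambda> \<mu> \<eta> m
    using assms(2-9) by unfold_locales
  define p where "p = time_changed_poisson_prob P N \<nu> \<mu> H A"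
  define L where "L = inverse_process N \<nu> \<mu> H"
  let ?S = "\<lambda>s \<omega>. \<Sum>j\<in>{1..N}. \<mu> j powr (1 / (real j * \<nu>)) * H j s \<omega>"
  have sub: "laplace_subordinator P ?S F.laplace_exponent"
    unfolding F.laplace_exponent_def[abs_def]
  proof (rule laplace_subordinator_sum)
    show "0 < (\<Sum>j\<in>{1..N}. \<mu> j * l powr (real j * \<nu>))" if "0 < l" for l
      using F.laplace_exponent_pos[OF that] by (simp only: F.laplace_exponent_def)
  qed (use assms F.order_bounds in auto)
  interpret S: laplace_subordinator "completion P" ?S F.laplace_exponent
    by (rule laplace_subordinator_completion[OF sub])
  have Lt: "L t = S.first_passage t" if "t > 0" for t
    unfolding L_def inverse_process_def S.first_passage_def using that by (intro ext) simp
  have L0: "L 0 \<omega> = 0" for \<omega> by (simp add: L_def inverse_process_def)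
  have nonneg: "AE \<omega> in completion P. 0 \<le> L t \<omega>" if "t \<ge> 0" for t
  proof (cases "t = 0")
    case False
    hence t: "t > 0" using that by simp
    show ?thesis unfolding Lt[OF t] using S.AE_first_passage[OF t] by eventually_elim blast
  qed (simp add: L0)
  note pois = time_changed_poisson_prob_eq[OF assms(1,12,5) _ assms(13)[folded L_def] nonneg]
  have p_int: "has_bochner_integral (completion P) (\<lambda>\<omega>. exp (- \<Lambda> * L t \<omega>) * (\<Lambda> * L t \<omega>) ^ k / fact k) (p k t)"
    if "t \<ge> 0" for k t
    using pois(1)[OF that that] by (simp add: p_def time_changed_poisson_prob_def L_def)
  \<comment> \<open>partial sums of Poisson weights are Erlang tail probabilities\<close>
  have partial: "(\<Sum>n\<le>k. p n t) = 1 - borel_transform \<nu> (F.\<psi> k) t" if t: "t > 0" for k t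
  proof -
    have t0: "t \<ge> 0" using t by simp
    have "has_bochner_integral (completion P)
        (\<lambda>\<omega>. \<Sum>n\<le>k. exp (- \<Lambda> * L t \<omega>) * (\<Lambda> * L t \<omega>) ^ n / fact n) (\<Sum>n\<le>k. p n t)"
      by (intro has_bochner_integral_sum p_int t0)
    hence "(\<Sum>n\<le>k. p n t) = (\<integral>\<omega>. (\<Sum>n\<le>k. exp (- \<Lambda> * L t \<omega>) * (\<Lambda> * L t \<omega>) ^ n / fact n) \<partial>completion P)"
      by (simp add: has_bochner_integral_iff)
    also have "\<dots> = (\<integral>\<omega>. 1 - erlang_CDF k \<Lambda> (L t \<omega>) \<partial>completion P)"
    proof (rule integral_cong_AE)
      show "(\<lambda>\<omega>. 1 - erlang_CDF k \<Lambda> (L t \<omega>)) \<in> borel_measurable (completion P)"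
        using pois(2)[OF t0 t0] unfolding erlang_CDF_def by measurable
      show "(\<lambda>\<omega>. \<Sum>n\<le>k. exp (- \<Lambda> * L t \<omega>) * (\<Lambda> * L t \<omega>) ^ n / fact n) \<in> borel_measurable (completion P)"
        using pois(2)[OF t0 t0] by measurable
      show "AE \<omega> in completion P. (\<Sum>n\<le>k. exp (- \<Lambda> * L t \<omega>) * (\<Lambda> * L t \<omega>) ^ n / fact n) = 1 - erlang_CDF k \<Lambda> (L t \<omega>)"
        using nonneg[OF t0] by eventually_elim (simp add: erlang_CDF_def mult.commute)
    qed
    also have "\<dots> = 1 - measure (S.erlang_mixture k \<Lambda>) {..<t}"
      using S.integral_erlang_CDF_first_passage[OF t assms(5), of k] pois(2)[OF t0 t0]
      by (simp add: Lt[OF t] has_bochner_integral_iff P.prob_space)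
    also have "measure (S.erlang_mixture k \<Lambda>) {..<t} = borel_transform \<nu> (F.\<psi> k) t"
      by (rule F.erlang_mixture_cdf[OF S.laplace_subordinator_axioms t])
    finally show ?thesis .
  qed
  have p_eq: "p k t = borel_transform \<nu> (F.\<phi> k) t" if t: "t \<ge> 0" for k t
  proof (cases "t = 0")
    case True
    have "p k 0 = (if k = 0 then 1 else 0)"
      using p_int[of 0 k] by (cases k) (simp_all add: L0 has_bochner_integral_iff P.prob_space)
    thus ?thesis by (simp add: True borel_transform_at_0 F.\<nu>0 F.\<phi>_nth_0)
  next
    case False
    hence t: "t > 0" using that by simp
    note add = borel_transform_add[OF F.\<nu>0 F.radius_\<phi> F.radius_\<psi>]
    show ?thesis
    proof (cases k)
      case 0
      have "borel_transform \<nu> (F.\<phi> 0) t + borel_transform \<nu> (F.\<psi> 0) t = 1"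
        using add[of 0 0 t] F.\<phi>_0 by (simp add: borel_transform_1 F.\<nu>0)
      thus ?thesis using partial[OF t, of 0] by (simp add: 0)
    next
      case (Suc k')
      have "borel_transform \<nu> (F.\<phi> k) t + borel_transform \<nu> (F.\<psi> k) t = borel_transform \<nu> (F.\<psi> k') t"
        using add[of k k t] F.\<phi>_Suc[of k'] by (simp add: Suc)
      thus ?thesis using partial[OF t, of k'] partial[OF t, of k] by (simp add: Suc)
    qed
  qed
  have "solves_fractional_poisson N \<nu> \<mu> \<Lambda> p"
    unfolding solves_fractional_poisson_def
  proof (intro conjI allI impI ballI)
    show "continuous_on {0..} (p k)" for k
      using continuous_on_borel_transform[OF F.\<nu>0 F.radius_\<phi>[of k]]
      by (rule continuous_on_eq) (simp add: p_eq)
    show "p 0 0 = 1" by (simp add: p_eq borel_transform_at_0 F.\<nu>0 F.\<phi>_nth_0)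
    show "p k 0 = 0" if "k \<ge> 1" for k
      using that by (simp add: p_eq borel_transform_at_0 F.\<nu>0 F.\<phi>_nth_0)
    fix k and t :: real assume t: "t > 0"
    have cong: "caputo_differentiable \<beta> (p k) t \<longleftrightarrow> caputo_differentiable \<beta> (borel_transform \<nu> (F.\<phi> k)) t"
      "caputo_deriv \<beta> (p k) t = caputo_deriv \<beta> (borel_transform \<nu> (F.\<phi> k)) t" for \<beta>
      by (rule caputo_cong[OF t p_eq], assumption)+
    show "caputo_differentiable (real j * \<nu>) (p k) t" if "j \<in> {1..N}" for j
      unfolding cong(1) by (rule F.caputo_\<phi>(1)[OF t that])
    show "(\<Sum>j=1..N. \<mu> j * caputo_deriv (real j * \<nu>) (p k) t) = - \<Lambda> * (p k t - (if k = 0 then 0 else p (k - 1) t))"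
      unfolding cong(2) F.caputo_\<phi>(2)[OF t] using t by (simp add: p_eq)
  qed
  moreover have "p k t = \<Lambda> ^ k * (\<Sum>j=1..N. \<mu> j * rpow t (\<nu> * (real N * (real k + 1) - real j) + 1 - 1) *
      mittag_leffler \<nu> (\<nu> * (real N * (real k + 1) - real j) + 1) M (\<lambda>j. real (m j * (k + 1))) (\<lambda>i. \<eta> i * rpow t \<nu>))"
    if "t \<ge> 0" for k t
    unfolding p_eq[OF that] by (rule F.borel_transform_\<phi>_eq_mittag_leffler[OF that])
  ultimately show ?thesis unfolding Let_def p_def by blast
qed

end
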